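(* Let $G$ be a discrete group, let $H$ be a proximate normal subgroup of $G$, and let $\rho$ be an irreducible complex representation of $H$ such that $\mathrm{Ind}_H^G(\rho)$ is Schur irreducible. Then $\mathrm{Ind}_H^G(\rho)$ is an irreducible representation of $G$.
   Context: "Discrete" means that $G$ is regarded as an abstract group with no further topology. For $g\in G$, $H^g = g^{-1}Hg$. A subgroup $H$ of $G$ is called proximate normal if for all $g \in G$ the group $H \cap H^g$ is a finite index normal subgroup of $H$ and the quotient $H/(H \cap H^g)$ is abelian. Representations are abstract (possibly infinite dimensional, not necessarily unitary) complex representations; irreducible means nonzero with no proper nonzero invariant subspace (algebraically). Induction is finite (compact) induction: for a representation $(\rho, W)$ of $H$, $\mathrm{Ind}_H^G(\rho)$ is the space of functions $f : G \to W$ with $f(hg) = \rho(h) f(g)$ for all $h \in H$, $g \in G$, and with support contained in a finite union of right cosets $Hx$ of $H$ in $G$, on which $G$ acts by right translation $(g\cdot f)(x) = f(xg)$. A representation $V$ of $G$ is Schur irreducible if $\mathrm{End}_G(V)$ (the space of $G$-linear endomorphisms of $V$) is one-dimensional over $\mathbb{C}$. *)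

theory Defs
  imports
    Complex_Main
    "HOL-Algebra.Coset"
    "HOL-Algebra.Group_Action"
    "HOL-Library.Function_Algebras"
begin

definition conj_subgroup :: "('g, 'm) monoid_scheme \<Rightarrow> 'g set \<Rightarrow> 'g \<Rightarrow> 'g set"
  where "conj_subgroup G H g = (inv\<^bsub>G\<^esub> g <#\<^bsub>G\<^esub> H) #>\<^bsub>G\<^esub> g"

definition proximate_normal :: "'g set \<Rightarrow> ('g, 'm) monoid_scheme \<Rightarrow> bool"
  where "proximate_normal H G \<longleftrightarrow>
    subgroup H G \<and>
    (\<forall>g \<in> carrier G.
      let K = H \<inter> conj_subgroup G H g; GH = G\<lparr>carrier := H\<rparr> in
        K \<lhd> GH \<and> finite (rcosets\<^bsub>GH\<^esub> K) \<and> comm_group (GH Mod K))"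

definition pointwise_scale :: "(complex \<Rightarrow> 'v \<Rightarrow> 'v) \<Rightarrow> complex \<Rightarrow> ('x \<Rightarrow> 'v) \<Rightarrow> 'x \<Rightarrow> 'v"
  where "pointwise_scale scale c f = (\<lambda>x. scale c (f x))"

text \<open>
  The representation space is a linear subspace \<open>V\<close> of a complex vector space whose
  underlying set is the whole type \<open>'v\<close>; neither has a topology or a dimension bound.  By the
  convention of \<^locale>\<open>group_action\<close>, the operators \<open>\<pi> g\<close> are undefined outside \<open>V\<close>.
\<close>

locale representation = group_action G V \<pi> + vector_space scale
  for G :: "('g, 'm) monoid_scheme" (structure)
    and scale :: "complex \<Rightarrow> 'v::ab_group_add \<Rightarrow> 'v"
    and V :: "'v set"
    and \<pi> :: "'g \<Rightarrow> 'v \<Rightarrow> 'v" +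
  assumes subspace_space: "subspace V"
    and action_add:
      "\<lbrakk>g \<in> carrier G; v \<in> V; w \<in> V\<rbrakk> \<Longrightarrow> \<pi> g (v + w) = \<pi> g v + \<pi> g w"
    and action_scale:
      "\<lbrakk>g \<in> carrier G; v \<in> V\<rbrakk> \<Longrightarrow> \<pi> g (scale c v) = scale c (\<pi> g v)"

locale irreducible_representation = representation +
  assumes nonzero: "V \<noteq> {0}"
    and no_proper_invariant:
      "\<lbrakk>subspace U; U \<subseteq> V; \<And>g u. \<lbrakk>g \<in> carrier G; u \<in> U\<rbrakk> \<Longrightarrow> \<pi> g u \<in> U\<rbrakk>
        \<Longrightarrow> U = {0} \<or> U = V"

text \<open>
  An endomorphism of \<open>V\<close> is extended by zero outside \<open>V\<close>, so that distinct elements of the set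
  below are distinct maps on \<open>V\<close> and the pointwise operations are those of the endomorphism space.
\<close>

definition endomorphisms ::
  "('g, 'm) monoid_scheme \<Rightarrow> (complex \<Rightarrow> 'v::ab_group_add \<Rightarrow> 'v) \<Rightarrow> 'v set
    \<Rightarrow> ('g \<Rightarrow> 'v \<Rightarrow> 'v) \<Rightarrow> ('v \<Rightarrow> 'v) set"
  where "endomorphisms G scale V \<pi> =
    {T. (\<forall>v. v \<notin> V \<longrightarrow> T v = 0) \<and>
        (\<forall>v \<in> V. T v \<in> V) \<and>
        (\<forall>v \<in> V. \<forall>w \<in> V. T (v + w) = T v + T w) \<and>
        (\<forall>c. \<forall>v \<in> V. T (scale c v) = scale c (T v)) \<and>
        (\<forall>g \<in> carrier G. \<forall>v \<in> V. T (\<pi> g v) = \<pi> g (T v))}"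

locale schur_irreducible_representation = representation +
  assumes dim_endomorphisms:
    "vector_space.dim (pointwise_scale scale) (endomorphisms G scale V \<pi>) = 1"

text \<open>
  Functions on the group \<open>G\<close> are extended by zero outside \<open>carrier G\<close>.
\<close>

definition ind_space ::
  "('g, 'm) monoid_scheme \<Rightarrow> 'g set \<Rightarrow> 'w::ab_group_add set \<Rightarrow> ('g \<Rightarrow> 'w \<Rightarrow> 'w) \<Rightarrow> ('g \<Rightarrow> 'w) set"
  where "ind_space G H W \<rho> =
    {f. (\<forall>x. x \<notin> carrier G \<longrightarrow> f x = 0) \<and>
        (\<forall>x \<in> carrier G. f x \<in> W) \<and>
        (\<forall>h \<in> H. \<forall>x \<in> carrier G. f (h \<otimes>\<^bsub>G\<^esub> x) = \<rho> h (f x)) \<and>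
        (\<exists>C \<subseteq> rcosets\<^bsub>G\<^esub> H. finite C \<and> {x. f x \<noteq> 0} \<subseteq> \<Union>C)}"

definition ind_action ::
  "('g, 'm) monoid_scheme \<Rightarrow> 'g set \<Rightarrow> 'w::ab_group_add set \<Rightarrow> ('g \<Rightarrow> 'w \<Rightarrow> 'w)
    \<Rightarrow> 'g \<Rightarrow> ('g \<Rightarrow> 'w) \<Rightarrow> ('g \<Rightarrow> 'w)"
  where "ind_action G H W \<rho> g =
    (\<lambda>f \<in> ind_space G H W \<rho>. \<lambda>x. if x \<in> carrier G then f (x \<otimes>\<^bsub>G\<^esub> g) else 0)"

lemma vector_space_pointwise_scale:
  assumes "vector_space scale"
  shows "vector_space (pointwise_scale scale)"
proof -
  interpret vector_space scale by fact
  show ?thesis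
    by unfold_locales
      (auto simp: pointwise_scale_def plus_fun_def scale_right_distrib scale_left_distrib)
qed

lemma (in representation) subspace_endomorphisms:
  "module.subspace (pointwise_scale scale) (endomorphisms G scale V \<pi>)"
proof -
  interpret E: vector_space "pointwise_scale scale :: complex \<Rightarrow> ('v \<Rightarrow> 'v) \<Rightarrow> 'v \<Rightarrow> 'v"
    by (rule vector_space_pointwise_scale) unfold_locales
  have act: "\<pi> g v \<in> V" if "g \<in> carrier G" "v \<in> V" for g v
    using element_image that by blast
  have "\<pi> g 0 = 0" if "g \<in> carrier G" for g
    using action_scale[OF that subspace_0[OF subspace_space], of 0] by simp
  then show ?thesis
    using subspace_space
    unfolding E.subspace_def
    by (auto simp: endomorphisms_def zero_fun_def plus_fun_def pointwise_scale_def act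
        action_add action_scale subspace_add subspace_scale subspace_0 scale_right_distrib
        algebra_simps)
qed

lemma representation_ind:
  fixes G :: "('g, 'm) monoid_scheme"
    and scale :: "complex \<Rightarrow> 'w::ab_group_add \<Rightarrow> 'w"
  assumes "group G" and "subgroup H G"
    and "representation (G\<lparr>carrier := H\<rparr>) scale W \<rho>"
  shows "representation G (pointwise_scale scale) (ind_space G H W \<rho>) (ind_action G H W \<rho>)"
proof -
  interpret G: group G by fact
  interpret H: subgroup H G by fact
  interpret R: representation "G\<lparr>carrier := H\<rparr>" scale W \<rho> by fact
  interpret E: vector_space "pointwise_scale scale :: complex \<Rightarrow> ('g \<Rightarrow> 'w) \<Rightarrow> 'g \<Rightarrow> 'w"
    by (rule vector_space_pointwise_scale) unfold_locales
  let ?V = "ind_space G H W \<rho>" and ?A = "ind_action G H W \<rho>"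
  have \<rho>0: "\<rho> h 0 = 0" if "h \<in> H" for h
    using R.action_scale[of h 0 0] that R.subspace_0[OF R.subspace_space] by simp
  have sub: "E.subspace ?V"
  proof (rule E.subspaceI)
    show "0 \<in> ?V"
      using R.subspace_0[OF R.subspace_space]
      by (auto simp: ind_space_def zero_fun_def \<rho>0)
  next
    fix f f' assume f: "f \<in> ?V" and f': "f' \<in> ?V"
    obtain C where C: "C \<subseteq> rcosets\<^bsub>G\<^esub> H" "finite C" "{x. f x \<noteq> 0} \<subseteq> \<Union>C"
      using f by (auto simp: ind_space_def)
    obtain C' where C': "C' \<subseteq> rcosets\<^bsub>G\<^esub> H" "finite C'" "{x. f' x \<noteq> 0} \<subseteq> \<Union>C'"
      using f' by (auto simp: ind_space_def)
    have "\<exists>D \<subseteq> rcosets\<^bsub>G\<^esub> H. finite D \<and> {x. f x + f' x \<noteq> 0} \<subseteq> \<Union>D"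
    proof (intro exI[of _ "C \<union> C'"] conjI)
      show "{x. f x + f' x \<noteq> 0} \<subseteq> \<Union>(C \<union> C')"
      proof
        fix x assume "x \<in> {x. f x + f' x \<noteq> 0}"
        then have "f x \<noteq> 0 \<or> f' x \<noteq> 0" by auto
        then show "x \<in> \<Union>(C \<union> C')" using C(3) C'(3) by blast
      qed
    qed (use C C' in auto)
    then show "f + f' \<in> ?V"
      using f f' by (simp add: ind_space_def plus_fun_def R.action_add
          R.subspace_add[OF R.subspace_space])
  next
    fix c f assume f: "f \<in> ?V"
    obtain C where C: "C \<subseteq> rcosets\<^bsub>G\<^esub> H" "finite C" "{x. f x \<noteq> 0} \<subseteq> \<Union>C"
      using f by (auto simp: ind_space_def)
    then have "{x. scale c (f x) \<noteq> 0} \<subseteq> \<Union>C" by auto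
    with C(1,2) have "\<exists>C \<subseteq> rcosets\<^bsub>G\<^esub> H. finite C \<and> {x. scale c (f x) \<noteq> 0} \<subseteq> \<Union>C"
      by blast
    then show "pointwise_scale scale c f \<in> ?V"
      using f by (simp add: ind_space_def pointwise_scale_def R.action_scale
          R.subspace_scale[OF R.subspace_space])
  qed
  have closed: "?A g f \<in> ?V" if g: "g \<in> carrier G" and f: "f \<in> ?V" for g f
  proof -
    obtain C where C: "C \<subseteq> rcosets\<^bsub>G\<^esub> H" "finite C" "{x. f x \<noteq> 0} \<subseteq> \<Union>C"
      using f by (auto simp: ind_space_def)
    let ?D = "(\<lambda>c. c #>\<^bsub>G\<^esub> inv\<^bsub>G\<^esub> g) ` C"
    have "?D \<subseteq> rcosets\<^bsub>G\<^esub> H"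
    proof
      fix d assume "d \<in> ?D"
      then obtain c where c: "c \<in> C" "d = c #>\<^bsub>G\<^esub> inv\<^bsub>G\<^esub> g" by auto
      then obtain a where a: "a \<in> carrier G" "c = H #>\<^bsub>G\<^esub> a"
        using C(1) by (auto simp: RCOSETS_def)
      have "d = H #>\<^bsub>G\<^esub> (a \<otimes>\<^bsub>G\<^esub> inv\<^bsub>G\<^esub> g)"
        using a g c by (simp add: G.coset_mult_assoc H.subset)
      then show "d \<in> rcosets\<^bsub>G\<^esub> H" using a g by (auto simp: RCOSETS_def)
    qed
    moreover have "{x. ?A g f x \<noteq> 0} \<subseteq> \<Union>?D"
    proof
      fix x assume "x \<in> {x. ?A g f x \<noteq> 0}"
      then have x: "x \<in> carrier G" "f (x \<otimes>\<^bsub>G\<^esub> g) \<noteq> 0"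
        using f by (auto simp: ind_action_def split: if_splits)
      then obtain c where c: "c \<in> C" "x \<otimes>\<^bsub>G\<^esub> g \<in> c" using C(3) by blast
      moreover have "x = (x \<otimes>\<^bsub>G\<^esub> g) \<otimes>\<^bsub>G\<^esub> inv\<^bsub>G\<^esub> g"
        using x g by (simp add: G.m_assoc)
      ultimately show "x \<in> \<Union>?D" by (auto simp: r_coset_def)
    qed
    ultimately have "\<exists>D \<subseteq> rcosets\<^bsub>G\<^esub> H. finite D \<and> {x. ?A g f x \<noteq> 0} \<subseteq> \<Union>D"
      using C(2) by blast
    moreover have "?A g f = (\<lambda>x. if x \<in> carrier G then f (x \<otimes>\<^bsub>G\<^esub> g) else 0)"
      using f by (simp add: ind_action_def)
    ultimately show ?thesis
      using f g by (simp add: ind_space_def G.m_assoc)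
  qed
  have comp: "?A g (?A h f) = ?A (g \<otimes>\<^bsub>G\<^esub> h) f"
    if "g \<in> carrier G" "h \<in> carrier G" "f \<in> ?V" for g h f
    using closed[of h f] that by (auto simp: ind_action_def G.m_assoc)
  have one: "?A \<one>\<^bsub>G\<^esub> f = f" if "f \<in> ?V" for f
    using that by (auto simp: ind_action_def ind_space_def)
  have bij: "?A g \<in> Bij ?V" if g: "g \<in> carrier G" for g
  proof -
    have "bij_betw (?A g) ?V ?V"
      by (rule bij_betw_byWitness[where f' = "?A (inv\<^bsub>G\<^esub> g)"])
        (use g in \<open>auto simp: comp one closed\<close>)
    then show ?thesis by (simp add: Bij_def ind_action_def)
  qed
  have act: "group_action G ?V ?A"
  proof (intro group_action.intro group_hom.intro group_hom_axioms.intro)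
    show "?A \<in> hom G (BijGroup ?V)"
    proof (rule homI)
      fix g h assume gh: "g \<in> carrier G" "h \<in> carrier G"
      have "?A (g \<otimes>\<^bsub>G\<^esub> h) f = compose ?V (?A g) (?A h) f" for f
        using comp[of g h f] gh
        by (cases "f \<in> ?V") (auto simp: compose_def ind_action_def)
      then show "?A (g \<otimes>\<^bsub>G\<^esub> h) = ?A g \<otimes>\<^bsub>BijGroup ?V\<^esub> ?A h"
        using gh bij by (auto simp: BijGroup_def)
    qed (simp add: BijGroup_def bij)
  qed (auto simp: group_BijGroup)
  show ?thesis
  proof (intro representation.intro act representation_axioms.intro sub)
    show "vector_space (pointwise_scale scale :: complex \<Rightarrow> ('g \<Rightarrow> 'w) \<Rightarrow> 'g \<Rightarrow> 'w)"
      by unfold_locales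
  qed (use E.subspace_add[OF sub] E.subspace_scale[OF sub] in
      \<open>auto simp: ind_action_def plus_fun_def pointwise_scale_def\<close>)
qed

end

theory Submission
  imports Defs
begin

text \<open>
  Write \<open>V\<close> for the induced representation, \<open>H\<^sup>x = x\<^sup>-\<^sup>1Hx\<close> and \<open>K\<^sub>x = H \<inter> H\<^sup>x\<close>.  The restriction of \<open>V\<close>
  to \<open>H\<close> is semisimple in the following sense: each of its elements lies in an \<open>H\<close>-submodule all of
  whose submodules have complements (\<open>in_complemented\<close>).  Indeed, the functions supported on a
  right coset \<open>Hx\<close> form an irreducible \<open>H\<^sup>x\<close>-module, a twist of \<open>\<rho>\<close>.  Since \<open>K\<^sub>x\<close> is normal of finite
  index in \<open>H\<^sup>x\<close>, Clifford's theorem (\<open>complemented_of_irreducible\<close>) makes this module semisimple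
  over \<open>K\<^sub>x\<close>.  The double coset \<open>HxH\<close> is a finite union of right cosets \<open>Hxh\<close>, and \<open>K\<^sub>x\<^sub>h = K\<^sub>x\<close> because
  \<open>K\<^sub>x\<close> is normal in \<open>H\<close>; so the functions supported on \<open>HxH\<close> are semisimple over \<open>K\<^sub>x\<close> and, by
  Maschke's theorem (\<open>complemented_of_finite_index\<close>), over \<open>H\<close>.

  Let \<open>U \<noteq> 0\<close> be a \<open>G\<close>-invariant subspace of \<open>V\<close>.  After a translation, some element of \<open>U\<close> does
  not vanish at the identity, so that evaluation at the identity is a nonzero \<open>H\<close>-map from \<open>U\<close> to
  \<open>W\<close>; it is onto by the irreducibility of \<open>\<rho>\<close>, and by semisimplicity it has an \<open>H\<close>-equivariant section
  \<open>s\<close> with values in \<open>U\<close> (\<open>section_into_invariant\<close>).  By Frobenius reciprocity \<open>s\<close> extends to an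
  endomorphism of \<open>V\<close> (\<open>frobenius_extension\<close>).  This is a scalar by Schur irreducibility, and the
  scalar is 1 because \<open>s\<close> is a section.  Hence \<open>s w\<close> is the function supported on \<open>H\<close> with
  value \<open>w\<close> at the identity.  So \<open>U\<close> contains all functions supported on \<open>H\<close>, and these generate \<open>V\<close>.
\<close>

section \<open>Invariant subspaces and complements\<close>

context representation
begin

interpretation G: group G
  using group_hom group_hom.axioms(1) by blast

lemma action_closed: "g \<in> carrier G \<Longrightarrow> v \<in> V \<Longrightarrow> \<pi> g v \<in> V"
  using element_image by blast

lemma action_one: "v \<in> V \<Longrightarrow> \<pi> \<one> v = v"
  using id_eq_one by (metis restrict_apply')

lemma action_inv_left: "g \<in> carrier G \<Longrightarrow> v \<in> V \<Longrightarrow> \<pi> (inv g) (\<pi> g v) = v"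
  using composition_rule[of v "inv g" g] by (simp add: action_one)

lemma action_inv_right: "g \<in> carrier G \<Longrightarrow> v \<in> V \<Longrightarrow> \<pi> g (\<pi> (inv g) v) = v"
  using composition_rule[of v g "inv g"] by (simp add: action_one)

lemma action_zero: "g \<in> carrier G \<Longrightarrow> \<pi> g 0 = 0"
  using action_scale[of g 0 0] subspace_0[OF subspace_space] by simp

lemma action_diff:
  assumes "g \<in> carrier G" "v \<in> V" "w \<in> V"
  shows "\<pi> g (v - w) = \<pi> g v - \<pi> g w"
proof -
  have "\<pi> g ((v - w) + w) = \<pi> g (v - w) + \<pi> g w"
    by (rule action_add) (use assms subspace_diff[OF subspace_space] in auto)
  then show ?thesis by simp
qed

lemma action_sum:
  assumes "g \<in> carrier G" "\<And>i. i \<in> I \<Longrightarrow> f i \<in> V"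
  shows "\<pi> g (\<Sum>i\<in>I. f i) = (\<Sum>i\<in>I. \<pi> g (f i))"
  using assms
  by (induction I rule: infinite_finite_induct)
    (auto simp: action_zero action_add subspace_sum[OF subspace_space])

text \<open>A \<open>K\<close>-submodule of \<open>V\<close>, where \<open>K\<close> is usually a subgroup of \<open>G\<close>.\<close>

definition invariant :: "'g set \<Rightarrow> 'v set \<Rightarrow> bool"
  where "invariant K U \<longleftrightarrow> subspace U \<and> U \<subseteq> V \<and> (\<forall>k\<in>K. \<forall>u\<in>U. \<pi> k u \<in> U)"

lemma invariant_subspace: "invariant K U \<Longrightarrow> subspace U"
  and invariant_subset: "invariant K U \<Longrightarrow> U \<subseteq> V"
  and invariant_act: "invariant K U \<Longrightarrow> k \<in> K \<Longrightarrow> u \<in> U \<Longrightarrow> \<pi> k u \<in> U"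
  by (auto simp: invariant_def)

lemma invariant_mono: "invariant H U \<Longrightarrow> K \<subseteq> H \<Longrightarrow> invariant K U"
  by (auto simp: invariant_def)

lemma invariant_0: "invariant K U \<Longrightarrow> 0 \<in> U"
  using invariant_subspace subspace_0 by blast

lemma invariant_zero: "K \<subseteq> carrier G \<Longrightarrow> invariant K {0}"
  using subspace_0[OF subspace_space] by (auto simp: invariant_def action_zero)

lemma invariant_Int: "invariant K A \<Longrightarrow> invariant K B \<Longrightarrow> invariant K (A \<inter> B)"
  by (auto simp: invariant_def subspace_inter)

lemma invariant_plus:
  assumes A: "invariant K A" and B: "invariant K B" and K: "K \<subseteq> carrier G"
  shows "invariant K {a + b | a b. a \<in> A \<and> b \<in> B}"
  unfolding invariant_def
proof (intro conjI ballI)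
  show "subspace {a + b | a b. a \<in> A \<and> b \<in> B}"
    using subspace_sums assms invariant_subspace by blast
  show "{a + b | a b. a \<in> A \<and> b \<in> B} \<subseteq> V"
    using invariant_subset[OF A] invariant_subset[OF B] subspace_add[OF subspace_space] by blast
next
  fix k u assume k: "k \<in> K" and "u \<in> {a + b | a b. a \<in> A \<and> b \<in> B}"
  then obtain a b where u: "u = a + b" "a \<in> A" "b \<in> B" by blast
  have "\<pi> k u = \<pi> k a + \<pi> k b"
    using u k K A B by (auto simp: invariant_def intro!: action_add)
  then show "\<pi> k u \<in> {a + b | a b. a \<in> A \<and> b \<in> B}"
    using invariant_act[OF A k u(2)] invariant_act[OF B k u(3)] by blast
qed

text \<open>
  The \<open>K\<close>-module \<open>M\<close> is semisimple, in the form that each submodule is a direct summand.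
\<close>

definition complemented :: "'g set \<Rightarrow> 'v set \<Rightarrow> bool"
  where "complemented K M \<longleftrightarrow>
    (\<forall>A. invariant K A \<and> A \<subseteq> M \<longrightarrow>
      (\<exists>B. invariant K B \<and> B \<subseteq> M \<and> A \<inter> B = {0} \<and> (\<forall>m\<in>M. \<exists>a\<in>A. \<exists>b\<in>B. m = a + b)))"

lemma complementedE:
  assumes "complemented K M" "invariant K A" "A \<subseteq> M"
  obtains B where "invariant K B" "B \<subseteq> M" "A \<inter> B = {0}"
    "\<And>m. m \<in> M \<Longrightarrow> \<exists>a\<in>A. \<exists>b\<in>B. m = a + b"
  using assms unfolding complemented_def by meson

lemma complemented_zero: "complemented K {0}"
  unfolding complemented_def
proof (intro allI impI)
  fix A assume A: "invariant K A \<and> A \<subseteq> {0}"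
  then have "A = {0}" using invariant_0 by blast
  with A show "\<exists>B. invariant K B \<and> B \<subseteq> {0} \<and> A \<inter> B = {0} \<and> (\<forall>m\<in>{0}. \<exists>a\<in>A. \<exists>b\<in>B. m = a + b)"
    by (intro exI[of _ A]) auto
qed

text \<open>
  The sum of two semisimple submodules is semisimple: a complement of \<open>N\<close> is obtained from a
  complement of \<open>N \<inter> A\<close> in \<open>A\<close> and one of \<open>(N + A) \<inter> B\<close> in \<open>B\<close>.
\<close>

lemma complemented_sum:
  assumes K: "K \<subseteq> carrier G"
    and A: "invariant K A" "complemented K A" "A \<subseteq> M"
    and B: "invariant K B" "complemented K B" "B \<subseteq> M"
    and M: "invariant K M" "\<And>m. m \<in> M \<Longrightarrow> \<exists>a\<in>A. \<exists>b\<in>B. m = a + b"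
  shows "complemented K M"
  unfolding complemented_def
proof (intro allI impI)
  fix N assume N: "invariant K N \<and> N \<subseteq> M"
  note sub = invariant_subspace[OF A(1)] invariant_subspace[OF B(1)]
    invariant_subspace[OF M(1)] invariant_subspace[OF conjunct1[OF N]]
  let ?NA = "{n + a | n a. n \<in> N \<and> a \<in> A}"
  have NA: "invariant K ?NA" by (rule invariant_plus) (use N A K in auto)
  obtain A' where A': "invariant K A'" "A' \<subseteq> A" "(N \<inter> A) \<inter> A' = {0}"
      "\<And>m. m \<in> A \<Longrightarrow> \<exists>a\<in>N \<inter> A. \<exists>b\<in>A'. m = a + b"
    using complementedE[OF A(2), of "N \<inter> A"] invariant_Int N A(1) by (metis inf_le2)
  obtain C where C: "invariant K C" "C \<subseteq> B" "(?NA \<inter> B) \<inter> C = {0}"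
      "\<And>m. m \<in> B \<Longrightarrow> \<exists>a\<in>?NA \<inter> B. \<exists>b\<in>C. m = a + b"
    using complementedE[OF B(2), of "?NA \<inter> B"] invariant_Int NA B(1) by (metis (no_types, lifting) inf_le2)
  let ?D = "{a + c | a c. a \<in> A' \<and> c \<in> C}"
  have "invariant K ?D" by (rule invariant_plus) (use A' C K in auto)
  moreover have "?D \<subseteq> M"
    using A'(2) C(2) A(3) B(3) subspace_add[OF sub(3)] by blast
  moreover have "N \<inter> ?D = {0}"
  proof
    show "N \<inter> ?D \<subseteq> {0}"
    proof
      fix n assume "n \<in> N \<inter> ?D"
      then obtain a c where n: "n \<in> N" "n = a + c" "a \<in> A'" "c \<in> C" by blast
      have "c = n + (- a)" using n by simp
      moreover have "- a \<in> A" using n A'(2) subspace_neg[OF sub(1)] by blast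
      ultimately have "c \<in> ?NA" using n by blast
      then have "c = 0" using n C by blast
      then show "n \<in> {0}" using n A'(2,3) by auto
    qed
    have "0 = 0 + (0::'v)" by simp
    then show "{0} \<subseteq> N \<inter> ?D"
      using N invariant_0 A'(1) C(1) by blast
  qed
  moreover have "\<exists>n\<in>N. \<exists>d\<in>?D. m = n + d" if mM: "m \<in> M" for m
  proof -
    obtain a b where m: "m = a + b" "a \<in> A" "b \<in> B" using M(2)[OF mM] by blast
    obtain n1 a1 c where b: "b = n1 + a1 + c" "n1 \<in> N" "a1 \<in> A" "c \<in> C"
      using C(4)[OF m(3)] by blast
    have "a + a1 \<in> A" using m b subspace_add[OF sub(1)] by blast
    then obtain n2 a2 where a: "a + a1 = n2 + a2" "n2 \<in> N" "a2 \<in> A'"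
      using A'(4) by blast
    have "m = (a + a1) + n1 + c" using m b by (simp add: algebra_simps)
    then have "m = (n1 + n2) + (a2 + c)" using a by (simp add: algebra_simps)
    moreover have "n1 + n2 \<in> N" using a b subspace_add[OF sub(4)] by blast
    ultimately show ?thesis using a b by blast
  qed
  ultimately show "\<exists>D. invariant K D \<and> D \<subseteq> M \<and> N \<inter> D = {0} \<and> (\<forall>m\<in>M. \<exists>n\<in>N. \<exists>d\<in>D. m = n + d)"
    by (intro exI[of _ ?D] conjI ballI)
qed

section \<open>Restriction to subgroups of finite index\<close>

text \<open>
  Each submodule \<open>A\<close> has a submodule \<open>B\<close> with \<open>A \<inter> B = 0\<close> for which \<open>A + B\<close> is
  essential, namely one maximal with the first property.
\<close>

lemma essential_sum_exists:
  assumes K: "K \<subseteq> carrier G" and A: "invariant K A" "A \<subseteq> M" and M: "invariant K M"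
  obtains B where "invariant K B" "B \<subseteq> M" "A \<inter> B = {0}"
    "\<And>X. invariant K X \<Longrightarrow> X \<subseteq> M \<Longrightarrow> X \<inter> {a + b | a b. a \<in> A \<and> b \<in> B} = {0} \<Longrightarrow> X = {0}"
proof -
  let ?\<A> = "{B. invariant K B \<and> B \<subseteq> M \<and> A \<inter> B = {0}}"
  have "\<exists>B\<in>?\<A>. \<forall>X\<in>?\<A>. B \<subseteq> X \<longrightarrow> X = B"
  proof (rule subset_Zorn_nonempty)
    have "{0} \<in> ?\<A>" using invariant_zero[OF K] invariant_0 A M by auto
    then show "?\<A> \<noteq> {}" by blast
  next
    fix \<C> assume ne: "\<C> \<noteq> {}" and ch: "subset.chain ?\<A> \<C>"
    have C: "\<And>B. B \<in> \<C> \<Longrightarrow> invariant K B \<and> B \<subseteq> M \<and> A \<inter> B = {0}"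
      and lin: "\<And>B B'. B \<in> \<C> \<Longrightarrow> B' \<in> \<C> \<Longrightarrow> B \<subseteq> B' \<or> B' \<subseteq> B"
      using ch by (auto simp: subset_chain_def)
    have sub: "subspace (\<Union>\<C>)"
    proof (rule subspaceI)
      show "0 \<in> \<Union>\<C>" using ne C invariant_0 by blast
    next
      fix x y assume "x \<in> \<Union>\<C>" "y \<in> \<Union>\<C>"
      then obtain B B' where B: "B \<in> \<C>" "B' \<in> \<C>" "x \<in> B" "y \<in> B'" by blast
      then obtain B'' where "B'' \<in> \<C>" "x \<in> B''" "y \<in> B''" using lin by blast
      then show "x + y \<in> \<Union>\<C>" using C invariant_subspace subspace_add by blast
    next
      fix c x assume "x \<in> \<Union>\<C>"
      then show "scale c x \<in> \<Union>\<C>" using C invariant_subspace subspace_scale by blast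
    qed
    have "invariant K (\<Union>\<C>)"
      unfolding invariant_def
    proof (intro conjI sub ballI)
      show "\<Union>\<C> \<subseteq> V" using C invariant_subset by blast
      show "\<pi> k u \<in> \<Union>\<C>" if "k \<in> K" "u \<in> \<Union>\<C>" for k u
        using C that unfolding invariant_def by blast
    qed
    moreover have "A \<inter> \<Union>\<C> = {0}" using C ne by auto
    moreover have "\<Union>\<C> \<subseteq> M" using C by blast
    ultimately show "\<Union>\<C> \<in> ?\<A>" by blast
  qed
  then obtain B where B_in: "B \<in> ?\<A>" and B_max: "\<forall>X\<in>?\<A>. B \<subseteq> X \<longrightarrow> X = B"
    by (rule bexE)
  have B: "invariant K B" "B \<subseteq> M" "A \<inter> B = {0}"
    using B_in by auto
  have max: "X = B" if "invariant K X" "X \<subseteq> M" "A \<inter> X = {0}" "B \<subseteq> X" for X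
    using B_max that by simp
  let ?E = "{a + b | a b. a \<in> A \<and> b \<in> B}"
  have "X = {0}" if X: "invariant K X" "X \<subseteq> M" "X \<inter> ?E = {0}" for X
  proof -
    let ?Y = "{b + x | b x. b \<in> B \<and> x \<in> X}"
    have Y: "invariant K ?Y" by (rule invariant_plus) (use B X K in auto)
    have "?Y \<subseteq> M" using B X subspace_add[OF invariant_subspace[OF M]] by blast
    moreover have "A \<inter> ?Y = {0}"
    proof
      show "A \<inter> ?Y \<subseteq> {0}"
      proof
        fix a assume "a \<in> A \<inter> ?Y"
        then obtain b x where a: "a \<in> A" "a = b + x" "b \<in> B" "x \<in> X" by blast
        have "x = a + (- b)" using a by simp
        moreover have "- b \<in> B" using a subspace_neg[OF invariant_subspace[OF B(1)]] by blast
        ultimately have "x \<in> ?E" using a by blast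
        then have "x = 0" using X a by blast
        then show "a \<in> {0}" using a B by auto
      qed
      show "{0} \<subseteq> A \<inter> ?Y" using invariant_0[OF A(1)] invariant_0[OF Y] by blast
    qed
    moreover have "B \<subseteq> ?Y"
    proof
      fix b assume "b \<in> B"
      moreover have "b = b + 0" by simp
      ultimately show "b \<in> ?Y" using invariant_0[OF X(1)] by blast
    qed
    ultimately have "?Y = B" using max Y by blast
    have "x = 0" if "x \<in> X" for x
    proof -
      have "x = 0 + x" by simp
      then have "x \<in> ?Y" using that invariant_0[OF B(1)] by blast
      then have "x \<in> B" using \<open>?Y = B\<close> by blast
      then have "x \<in> ?E" using \<open>x = 0 + x\<close> invariant_0[OF A(1)] by blast
      then show ?thesis using X that by blast
    qed
    then show ?thesis using invariant_0[OF X(1)] by blast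
  qed
  with B that show ?thesis by blast
qed

text \<open>
  Clifford's theorem.  The finite set \<open>F\<close> meets each left coset of \<open>K\<close> in \<open>L\<close>.
  If \<open>E\<close> is an essential \<open>K\<close>-submodule of \<open>M\<close>, then so is the intersection
  of its finitely many translates under \<open>L\<close>.  If \<open>M \<noteq> 0\<close>, this intersection is nonzero, and as it is
  \<open>L\<close>-invariant it is equal to \<open>M\<close>; hence \<open>E = M\<close>.
\<close>

lemma complemented_of_irreducible:
  assumes L: "subgroup L G" and K: "subgroup K G" "K \<subseteq> L"
    and normal: "\<And>l k. l \<in> L \<Longrightarrow> k \<in> K \<Longrightarrow> inv l \<otimes> k \<otimes> l \<in> K"
    and F: "finite F" "F \<subseteq> L" "\<And>l. l \<in> L \<Longrightarrow> \<exists>f\<in>F. inv f \<otimes> l \<in> K"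
    and M: "invariant L M"
    and irred: "\<And>U. invariant L U \<Longrightarrow> U \<subseteq> M \<Longrightarrow> U = {0} \<or> U = M"
  shows "complemented K M"
  unfolding complemented_def
proof (intro allI impI)
  fix A assume A: "invariant K A \<and> A \<subseteq> M"
  interpret L: subgroup L G by fact
  interpret K: subgroup K G by fact
  have MK: "invariant K M" using M K(2) invariant_mono by blast
  obtain B where B: "invariant K B" "B \<subseteq> M" "A \<inter> B = {0}"
    and ess: "\<And>X. invariant K X \<Longrightarrow> X \<subseteq> M \<Longrightarrow> X \<inter> {a + b | a b. a \<in> A \<and> b \<in> B} = {0} \<Longrightarrow> X = {0}"
    by (rule essential_sum_exists[OF K.subset conjunct1[OF A] conjunct2[OF A] MK], rule that)
  define E where "E = {a + b | a b. a \<in> A \<and> b \<in> B}"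
  have E: "invariant K E"
    unfolding E_def by (rule invariant_plus) (use A B K.subset in auto)
  have MV: "M \<subseteq> V" using M invariant_subset by blast
  \<comment> \<open>The intersection of \<open>M\<close> with the translates of \<open>E\<close> by the elements of a set.\<close>
  define J where "J F' = {v\<in>M. \<forall>f\<in>F'. \<pi> (inv f) v \<in> E}" for F'
  have subJ: "subspace (J F')" if "F' \<subseteq> L" for F'
  proof (rule subspaceI)
    show "0 \<in> J F'" using that invariant_0[OF M] invariant_0[OF E]
      by (auto simp: J_def action_zero)
  next
    fix x y assume xy: "x \<in> J F'" "y \<in> J F'"
    then show "x + y \<in> J F'"
      using MV subspace_add[OF invariant_subspace[OF M]]
        subspace_add[OF invariant_subspace[OF E]] that
      by (auto simp: J_def action_add subset_iff)
  next
    fix c x assume "x \<in> J F'"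
    then show "scale c x \<in> J F'"
      using MV subspace_scale[OF invariant_subspace[OF M]]
        subspace_scale[OF invariant_subspace[OF E]] that
      by (auto simp: J_def action_scale subset_iff)
  qed
  have invJ: "invariant K (J F')" if F': "F' \<subseteq> L" for F'
    unfolding invariant_def
  proof (intro conjI ballI subJ that)
    show "J F' \<subseteq> V" using MV by (auto simp: J_def)
    fix k v assume k: "k \<in> K" and v: "v \<in> J F'"
    have "\<pi> (inv f) (\<pi> k v) \<in> E" if f: "f \<in> F'" for f
    proof -
      have fc: "f \<in> L" "f \<in> carrier G" using f F' by auto
      have vV: "v \<in> V" using v MV by (auto simp: J_def)
      have "\<pi> (inv f) (\<pi> k v) = \<pi> (inv f \<otimes> k) v"
        using fc k vV by (simp add: composition_rule)
      also have "inv f \<otimes> k = (inv f \<otimes> k \<otimes> f) \<otimes> inv f"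
        using fc k by (simp add: G.m_assoc)
      also have "\<pi> \<dots> v = \<pi> (inv f \<otimes> k \<otimes> f) (\<pi> (inv f) v)"
        using fc k vV by (intro composition_rule) auto
      finally show ?thesis
        using v f normal[OF fc(1) k] E by (auto simp: J_def invariant_def)
    qed
    moreover have "\<pi> k v \<in> M" using v k MK by (auto simp: J_def invariant_def)
    ultimately show "\<pi> k v \<in> J F'" by (auto simp: J_def)
  qed
  have essJ: "X \<inter> J F' \<noteq> {0}"
    if "finite F'" "F' \<subseteq> L" "invariant K X" "X \<subseteq> M" "X \<noteq> {0}" for F' X
    using that
  proof (induction F')
    case empty
    then show ?case by (auto simp: J_def)
  next
    case (insert f F')
    let ?X = "X \<inter> J F'"
    have X0: "?X \<noteq> {0}" and X: "invariant K ?X" "?X \<subseteq> M"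
      using insert invJ invariant_Int by auto
    have XV: "?X \<subseteq> V" using X MV by blast
    have f: "f \<in> L" "f \<in> carrier G" "inv f \<in> carrier G" using insert by auto
    \<comment> \<open>As \<open>K\<close> is normal, the translate of a \<open>K\<close>-submodule is again one, so it meets \<open>E\<close>.\<close>
    let ?Y = "\<pi> (inv f) ` ?X"
    have sY: "subspace ?Y"
    proof (rule subspaceI)
      show "0 \<in> ?Y" using invariant_0[OF X(1)] action_zero[OF f(3)] by force
    next
      fix x y assume "x \<in> ?Y" "y \<in> ?Y"
      then obtain u v where uv: "x = \<pi> (inv f) u" "y = \<pi> (inv f) v" "u \<in> ?X" "v \<in> ?X" by blast
      then have "x + y = \<pi> (inv f) (u + v)" using XV f by (auto simp: action_add subset_iff)
      then show "x + y \<in> ?Y" using uv subspace_add[OF invariant_subspace[OF X(1)]] by blast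
    next
      fix c x assume "x \<in> ?Y"
      then obtain u where u: "x = \<pi> (inv f) u" "u \<in> ?X" by blast
      then have "scale c x = \<pi> (inv f) (scale c u)" using XV f by (auto simp: action_scale subset_iff)
      then show "scale c x \<in> ?Y" using u subspace_scale[OF invariant_subspace[OF X(1)]] by blast
    qed
    have Y: "invariant K ?Y"
      unfolding invariant_def
    proof (intro conjI ballI sY)
      show "?Y \<subseteq> V" using XV f action_closed by blast
      fix k y assume k: "k \<in> K" and "y \<in> ?Y"
      then obtain u where u: "y = \<pi> (inv f) u" "u \<in> ?X" by blast
      have uV: "u \<in> V" using u XV by blast
      have fk: "f \<otimes> k \<otimes> inv f \<in> K"
        using normal[of "inv f" k] f k by simp
      have "\<pi> k y = \<pi> (k \<otimes> inv f) u" using u uV k f by (simp add: composition_rule)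
      also have "k \<otimes> inv f = inv f \<otimes> (f \<otimes> k \<otimes> inv f)"
        using k f by (simp add: G.m_assoc[symmetric])
      also have "\<pi> \<dots> u = \<pi> (inv f) (\<pi> (f \<otimes> k \<otimes> inv f) u)"
        using uV f k by (intro composition_rule) auto
      finally show "\<pi> k y \<in> ?Y" using invariant_act[OF X(1) fk u(2)] by blast
    qed
    have "?Y \<subseteq> M"
      using X invariant_act[OF M L.m_inv_closed[OF f(1)]] by blast
    moreover have "?Y \<noteq> {0}"
    proof
      assume Y0: "?Y = {0}"
      have "u = 0" if "u \<in> ?X" for u
      proof -
        have "\<pi> (inv f) u = 0" using that Y0 by blast
        then show ?thesis using action_inv_right[of f u] that XV f action_zero[of f] by auto
      qed
      then show False using X0 invariant_0[OF X(1)] by blast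
    qed
    ultimately have "?Y \<inter> E \<noteq> {0}" using ess[OF Y] E_def by blast
    then obtain y where y: "y \<in> ?Y" "y \<in> E" "y \<noteq> 0"
      using invariant_0[OF Y] invariant_0[OF E] by blast
    then obtain u where u: "y = \<pi> (inv f) u" "u \<in> ?X" by blast
    have "u \<noteq> 0" using u y action_zero[OF f(3)] by blast
    moreover have "u \<in> X \<inter> J (insert f F')" using u y by (auto simp: J_def)
    ultimately show ?case by blast
  qed
  have "invariant L (J F)"
    unfolding invariant_def
  proof (intro conjI ballI subJ F(2))
    show "J F \<subseteq> V" using MV by (auto simp: J_def)
    fix l v assume l: "l \<in> L" and v: "v \<in> J F"
    have vV: "v \<in> V" using v MV by (auto simp: J_def)
    have "\<pi> (inv f) (\<pi> l v) \<in> E" if f: "f \<in> F" for f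
    proof -
      have fL: "f \<in> L" using f F by blast
      obtain f' where f': "f' \<in> F" "inv f' \<otimes> (inv l \<otimes> f) \<in> K"
        using F(3)[of "inv l \<otimes> f"] l fL by auto
      have f'L: "f' \<in> L" using f' F by blast
      define k where "k = inv (inv f' \<otimes> (inv l \<otimes> f))"
      have k: "k \<in> K" using f' by (simp add: k_def)
      have "\<pi> (inv f) (\<pi> l v) = \<pi> (inv f \<otimes> l) v"
        using fL l vV by (simp add: composition_rule)
      also have "inv f \<otimes> l = k \<otimes> inv f'"
        using fL l f'L by (simp add: k_def G.inv_mult_group G.m_assoc)
      also have "\<pi> \<dots> v = \<pi> k (\<pi> (inv f') v)"
        using f'L k vV by (intro composition_rule) auto
      finally show ?thesis using v f' k E by (auto simp: J_def invariant_def)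
    qed
    moreover have "\<pi> l v \<in> M" using v l M by (auto simp: J_def invariant_def)
    ultimately show "\<pi> l v \<in> J F" by (auto simp: J_def)
  qed
  then have J: "J F = {0} \<or> J F = M" using irred by (auto simp: J_def)
  have JM: "J F = M"
  proof (cases "M = {0}")
    case False
    then have "M \<inter> J F \<noteq> {0}" using essJ F MK by blast
    then show ?thesis using J invariant_0[OF M] by blast
  qed (use J in auto)
  have "m \<in> E" if m: "m \<in> M" for m
  proof -
    obtain f where f: "f \<in> F" using F(3)[OF L.one_closed] by blast
    have "\<pi> f m \<in> J F" using m f F M JM by (auto simp: invariant_def)
    then have "\<pi> (inv f) (\<pi> f m) \<in> E" using f by (auto simp: J_def)
    moreover have "\<pi> (inv f) (\<pi> f m) = m"
      by (rule action_inv_left) (use f F(2) MV m L.subset in blast)+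
    ultimately show ?thesis by simp
  qed
  then have "\<forall>m\<in>M. \<exists>a\<in>A. \<exists>b\<in>B. m = a + b" unfolding E_def by blast
  with B show "\<exists>B. invariant K B \<and> B \<subseteq> M \<and> A \<inter> B = {0} \<and> (\<forall>m\<in>M. \<exists>a\<in>A. \<exists>b\<in>B. m = a + b)"
    by blast
qed

text \<open>
  Maschke's theorem: a \<open>K\<close>-equivariant projection onto an \<open>L\<close>-submodule is made \<open>L\<close>-equivariant
  by averaging over the left cosets of \<open>K\<close> in \<open>L\<close>.
\<close>

lemma complemented_of_finite_index:
  assumes L: "subgroup L G" and K: "subgroup K G" "K \<subseteq> L"
    and F: "finite F" "F \<subseteq> L" "\<And>l. l \<in> L \<Longrightarrow> \<exists>f\<in>F. inv f \<otimes> l \<in> K"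
    and M: "invariant L M" and compl: "complemented K M"
  shows "complemented L M"
  unfolding complemented_def
proof (intro allI impI)
  fix A assume A: "invariant L A \<and> A \<subseteq> M"
  then have AL: "invariant L A" and AM: "A \<subseteq> M" by auto
  interpret L: subgroup L G by fact
  interpret K: subgroup K G by fact
  have AK: "invariant K A" and MK: "invariant K M" using AL M K(2) invariant_mono by blast+
  have MV: "M \<subseteq> V" using M invariant_subset by blast
  obtain B where B: "invariant K B" "B \<subseteq> M" "A \<inter> B = {0}"
      "\<And>m. m \<in> M \<Longrightarrow> \<exists>a\<in>A. \<exists>b\<in>B. m = a + b"
    by (rule complementedE[OF compl AK AM], rule that)
  note sA = invariant_subspace[OF AL] and sB = invariant_subspace[OF B(1)]
    and sM = invariant_subspace[OF M]
  define e where "e m = (SOME a. a \<in> A \<and> m - a \<in> B)" for m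
  have e: "e m \<in> A" "m - e m \<in> B" if "m \<in> M" for m
  proof -
    have "\<exists>a. a \<in> A \<and> m - a \<in> B" using B(4)[OF that] by force
    from someI_ex[OF this] show "e m \<in> A" "m - e m \<in> B" by (auto simp: e_def)
  qed
  have e_unique: "e m = a" if "m \<in> M" "a \<in> A" "m - a \<in> B" for m a
  proof -
    have "(m - a) - (m - e m) \<in> B" using that e subspace_diff[OF sB] by blast
    then have "e m - a \<in> B" by simp
    moreover have "e m - a \<in> A" using that e subspace_diff[OF sA] by blast
    ultimately have "e m - a = 0" using B(3) by blast
    then show ?thesis by simp
  qed
  have e_add: "e (x + y) = e x + e y" if "x \<in> M" "y \<in> M" for x y
  proof (rule e_unique)
    have "(x - e x) + (y - e y) \<in> B" using e that subspace_add[OF sB] by blast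
    then show "x + y - (e x + e y) \<in> B" by (simp add: algebra_simps)
  qed (use e that subspace_add[OF sM] subspace_add[OF sA] in auto)
  have e_scale: "e (scale c x) = scale c (e x)" if "x \<in> M" for c x
  proof (rule e_unique)
    have "scale c (x - e x) \<in> B" using e that subspace_scale[OF sB] by blast
    then show "scale c x - scale c (e x) \<in> B" by (simp add: scale_right_diff_distrib)
  qed (use e that subspace_scale[OF sM] subspace_scale[OF sA] in auto)
  have e_act: "e (\<pi> k x) = \<pi> k (e x)" if "x \<in> M" "k \<in> K" for k x
  proof (rule e_unique)
    have "\<pi> k (x - e x) \<in> B" using e that invariant_act[OF B(1)] by blast
    moreover have "\<pi> k (x - e x) = \<pi> k x - \<pi> k (e x)"
      using e that MV AM by (intro action_diff) auto
    ultimately show "\<pi> k x - \<pi> k (e x) \<in> B" by simp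
  qed (use e that invariant_act[OF MK] invariant_act[OF AK] in auto)
  have e_id: "e a = a" if "a \<in> A" for a
    by (rule e_unique) (use that AM subspace_0[OF sB] in auto)
  \<comment> \<open>The conjugate of the projection by \<open>l\<close> depends only on the coset of \<open>l\<close>.\<close>
  define c where "c l m = \<pi> l (e (\<pi> (inv l) m))" for l m
  have inM: "\<pi> l m \<in> M" if "l \<in> L" "m \<in> M" for l m using M that by (auto simp: invariant_def)
  have inA: "\<pi> l a \<in> A" if "l \<in> L" "a \<in> A" for l a using AL that by (auto simp: invariant_def)
  have c_A: "c l m \<in> A" if "l \<in> L" "m \<in> M" for l m
    using that by (simp add: c_def inA inM e)
  have c_coset: "c (l \<otimes> k) m = c l m" if l: "l \<in> L" and k: "k \<in> K" and m: "m \<in> M" for l k m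
  proof -
    have lM: "\<pi> (inv l) m \<in> M" using inM l m by blast
    have "\<pi> (inv (l \<otimes> k)) m = \<pi> (inv k) (\<pi> (inv l) m)"
      using l k m MV by (auto simp: G.inv_mult_group composition_rule subset_iff)
    then have "e (\<pi> (inv (l \<otimes> k)) m) = \<pi> (inv k) (e (\<pi> (inv l) m))"
      using e_act[OF lM] k by simp
    moreover have "e (\<pi> (inv l) m) \<in> V" using e[OF lM] AM MV by blast
    ultimately show ?thesis
      using l k by (simp add: c_def composition_rule action_closed action_inv_right)
  qed
  define Q where "Q = (\<lambda>l. l <# K) ` L"
  define r where "r C = (SOME l. l \<in> L \<and> C = l <# K)" for C
  have r: "r C \<in> L" "C = r C <# K" if "C \<in> Q" for C
  proof -
    have "\<exists>l. l \<in> L \<and> C = l <# K" using that by (auto simp: Q_def)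
    from someI_ex[OF this] show "r C \<in> L" "C = r C <# K" by (auto simp: r_def)
  qed
  have rc: "c (r (l <# K)) m = c l m" if l: "l \<in> L" and m: "m \<in> M" for l m
  proof -
    have q: "l <# K \<in> Q" using l by (auto simp: Q_def)
    have "l \<in> l <# K" using l K.one_closed by (force simp: l_coset_def)
    then have "l \<in> r (l <# K) <# K" using r(2)[OF q] by simp
    then obtain k where "k \<in> K" "l = r (l <# K) \<otimes> k" by (auto simp: l_coset_def)
    then show ?thesis using c_coset[OF r(1)[OF q] _ m] by metis
  qed
  have finQ: "finite Q"
  proof (rule finite_subset)
    show "Q \<subseteq> (\<lambda>f. f <# K) ` F"
    proof
      fix C assume "C \<in> Q"
      then obtain l where l: "l \<in> L" "C = l <# K" by (auto simp: Q_def)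
      obtain f where f: "f \<in> F" "inv f \<otimes> l \<in> K" using F(3) l by blast
      have fL: "f \<in> carrier G" "l \<in> carrier G" using f F l by auto
      have "l = f \<otimes> (inv f \<otimes> l)" using fL by (simp add: G.m_assoc[symmetric])
      then have "l \<in> f <# K" using f unfolding l_coset_def by blast
      then have "f <# K = l <# K" using G.l_repr_independence fL K(1) by blast
      then show "C \<in> (\<lambda>f. f <# K) ` F" using l f by blast
    qed
  qed (use F in auto)
  have Qne: "Q \<noteq> {}" using L.one_closed unfolding Q_def by blast
  \<comment> \<open>Undivided average: \<open>p\<close> acts on \<open>A\<close> as multiplication by the index of \<open>K\<close> in \<open>L\<close>.\<close>
  define p where "p m = (\<Sum>C\<in>Q. c (r C) m)" for m
  have p_A: "p m \<in> A" if "m \<in> M" for m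
    unfolding p_def by (rule subspace_sum[OF sA]) (use c_A r that in auto)
  have c_add: "c l (x + y) = c l x + c l y" if "l \<in> L" "x \<in> M" "y \<in> M" for l x y
    unfolding c_def
    using that MV AM inM[of "inv l"] e by (simp add: action_add e_add subset_iff)
  have c_scale: "c l (scale a x) = scale a (c l x)" if "l \<in> L" "x \<in> M" for l a x
    unfolding c_def
    using that MV AM inM[of "inv l"] e by (simp add: action_scale e_scale subset_iff)
  have p_add: "p (x + y) = p x + p y" if "x \<in> M" "y \<in> M" for x y
    unfolding p_def using that r by (simp add: c_add sum.distrib)
  have p_scale: "p (scale a x) = scale a (p x)" if "x \<in> M" for a x
    unfolding p_def using that r by (simp add: c_scale scale_sum_right)
  have p_act: "p (\<pi> l m) = \<pi> l (p m)" if l: "l \<in> L" and m: "m \<in> M" for l m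
  proof -
    have mV: "m \<in> V" using m MV by blast
    have step: "\<pi> l (c (r C) m) = c (r (l <# C)) (\<pi> l m)" if C: "C \<in> Q" for C
    proof -
      let ?x = "r C"
      have x: "?x \<in> L" using r C by blast
      have "l <# C = (l \<otimes> ?x) <# K"
        using r(2)[OF C] x l G.lcos_m_assoc[of K l ?x] K.subset by auto
      then have "c (r (l <# C)) (\<pi> l m) = c (l \<otimes> ?x) (\<pi> l m)"
        using rc x l inM m by simp
      also have "\<dots> = \<pi> (l \<otimes> ?x) (e (\<pi> (inv ?x \<otimes> inv l) (\<pi> l m)))"
        using x l by (simp add: c_def G.inv_mult_group)
      also have "\<pi> (inv ?x \<otimes> inv l) (\<pi> l m) = \<pi> (inv ?x) m"
        using x l mV by (simp add: composition_rule action_inv_left action_closed)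
      also have "\<pi> (l \<otimes> ?x) (e (\<pi> (inv ?x) m)) = \<pi> l (c ?x m)"
      proof -
        have "e (\<pi> (inv ?x) m) \<in> V" using e inM x m AM MV L.m_inv_closed by blast
        then show ?thesis using x l by (simp add: c_def composition_rule)
      qed
      finally show ?thesis by simp
    qed
    have mult: "l <# C \<in> Q" if "l \<in> L" "C \<in> Q" for l C
      using that K.subset by (auto simp: Q_def G.lcos_m_assoc)
    have canc: "inv l <# (l <# C) = C \<and> l <# (inv l <# C) = C" if "C \<in> Q" for C
    proof -
      have "C \<subseteq> carrier G" using that K.subset by (auto simp: Q_def l_coset_def)
      then show ?thesis using l by (simp add: G.lcos_m_assoc G.lcos_mult_one)
    qed
    have "\<pi> l (p m) = (\<Sum>C\<in>Q. \<pi> l (c (r C) m))"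
      unfolding p_def
    proof (rule action_sum)
      show "c (r C) m \<in> V" if "C \<in> Q" for C
        using c_A[OF r(1)[OF that] m] AM MV by blast
    qed (use l in simp)
    also have "\<dots> = (\<Sum>C\<in>Q. c (r (l <# C)) (\<pi> l m))"
      by (rule sum.cong) (auto simp: step)
    also have "\<dots> = (\<Sum>C\<in>Q. c (r C) (\<pi> l m))"
      by (rule sum.reindex_bij_witness[of _ "\<lambda>C. inv l <# C" "\<lambda>C. l <# C"])
        (use mult canc l in auto)
    finally show ?thesis by (simp add: p_def)
  qed
  have p_id: "p a = scale (of_nat (card Q)) a" if a: "a \<in> A" for a
  proof -
    have "c (r C) a = a" if "C \<in> Q" for C
    proof -
      have x: "r C \<in> L" using r that by blast
      have "a \<in> V" using a AM MV by blast
      then show ?thesis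
        using x a inA[of "inv (r C)" a] by (simp add: c_def e_id action_inv_right)
    qed
    then have "p a = (\<Sum>C\<in>Q. a)" unfolding p_def by (intro sum.cong) auto
    then show ?thesis by (simp add: sum_constant_scale)
  qed
  have n0: "(of_nat (card Q) :: complex) \<noteq> 0" using finQ Qne by simp
  define D where "D = {m\<in>M. p m = 0}"
  have sD: "subspace D"
  proof (rule subspaceI)
    have "p 0 = scale 0 (p 0)" using p_scale[of 0 0] subspace_0[OF sM] by simp
    then show "0 \<in> D" using subspace_0[OF sM] by (simp add: D_def)
  qed (auto simp: D_def p_add p_scale subspace_add[OF sM] subspace_scale[OF sM])
  have "invariant L D"
    unfolding invariant_def
    by (intro conjI ballI sD) (use MV inM in \<open>auto simp: D_def p_act action_zero\<close>)
  moreover have "A \<inter> D = {0}"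
  proof
    show "A \<inter> D \<subseteq> {0}" using p_id n0 by (auto simp: D_def)
    show "{0} \<subseteq> A \<inter> D" using subspace_0[OF sA] subspace_0[OF sD] by auto
  qed
  moreover have "\<exists>a\<in>A. \<exists>d\<in>D. m = a + d" if m: "m \<in> M" for m
  proof -
    define a where "a = scale (1 / of_nat (card Q)) (p m)"
    have a: "a \<in> A" unfolding a_def using p_A m subspace_scale[OF sA] by blast
    have "p a = p m" using p_id[OF a] n0 by (simp add: a_def)
    moreover have "p m = p (m - a) + p a" using p_add[of "m - a" a] m a AM subspace_diff[OF sM] by auto
    ultimately have "m - a \<in> D" using m a AM subspace_diff[OF sM] by (auto simp: D_def)
    then show ?thesis using a by (intro bexI[of _ a] bexI[of _ "m - a"]) auto
  qed
  moreover have "D \<subseteq> M" by (auto simp: D_def)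
  ultimately show "\<exists>B. invariant L B \<and> B \<subseteq> M \<and> A \<inter> B = {0} \<and> (\<forall>m\<in>M. \<exists>a\<in>A. \<exists>b\<in>B. m = a + b)"
    by blast
qed

end

section \<open>Endomorphisms of Schur irreducible representations\<close>

text \<open>
  Unless \<open>V = 0\<close>, the identity map, extended by zero, is a nonzero vector of the one-dimensional
  space of endomorphisms, so that each endomorphism is a multiple of it.
\<close>

lemma (in schur_irreducible_representation) endomorphism_scalar:
  assumes T: "T \<in> endomorphisms G scale V \<pi>"
  obtains c where "\<And>v. v \<in> V \<Longrightarrow> T v = scale c v"
proof -
  interpret E: vector_space "pointwise_scale scale :: complex \<Rightarrow> ('c \<Rightarrow> 'c) \<Rightarrow> 'c \<Rightarrow> 'c"
    by (rule vector_space_pointwise_scale) unfold_locales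
  let ?E = "endomorphisms G scale V \<pi>" and ?id = "\<lambda>v. if v \<in> V then v else 0"
  obtain B where B: "B \<subseteq> ?E" "?E \<subseteq> E.span B" "card B = 1"
    using E.basis_exists[of ?E] dim_endomorphisms by metis
  then obtain b where b: "B = {b}" using card_1_singletonE by blast
  have scalar: "\<exists>c. S = pointwise_scale scale c b" if "S \<in> ?E" for S
    using that B(2) b E.span_singleton[of b] by auto
  have "?id \<in> ?E"
    using action_closed subspace_add[OF subspace_space] subspace_scale[OF subspace_space]
    by (auto simp: endomorphisms_def)
  then obtain d where d: "?id = pointwise_scale scale d b" using scalar by blast
  obtain c where c: "T = pointwise_scale scale c b" using scalar T by blast
  have "T v = scale (c / d) v" if v: "v \<in> V" for v
  proof -
    have v': "v = scale d (b v)" using fun_cong[OF d, of v] v by (simp add: pointwise_scale_def)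
    show ?thesis
    proof (cases "d = 0")
      case True
      then have "v = 0" using v' by simp
      then show ?thesis using T subspace_0[OF subspace_space] scale_zero_right
        unfolding endomorphisms_def by (metis (mono_tags, lifting) mem_Collect_eq scale_zero_left)
    next
      case False
      then have "scale (c / d) v = scale c (b v)" by (subst v') simp
      then show ?thesis using c by (simp add: pointwise_scale_def)
    qed
  qed
  then show ?thesis using that by blast
qed

lemma (in schur_irreducible_representation) space_nonzero: "V \<noteq> {0}"
proof
  assume V: "V = {0}"
  interpret E: vector_space "pointwise_scale scale :: complex \<Rightarrow> ('c \<Rightarrow> 'c) \<Rightarrow> 'c \<Rightarrow> 'c"
    by (rule vector_space_pointwise_scale) unfold_locales
  have "T = 0" if "T \<in> endomorphisms G scale V \<pi>" for T
    using that V by (auto simp: endomorphisms_def fun_eq_iff) metis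
  then have "endomorphisms G scale V \<pi> \<subseteq> {0}" by blast
  then have "E.dim (endomorphisms G scale V \<pi>) \<le> card ({} :: ('c \<Rightarrow> 'c) set)"
    by (intro E.dim_le_card) auto
  then show False using dim_endomorphisms by simp
qed

section \<open>Conjugates of a proximate normal subgroup\<close>

context group
begin

lemma mult_inv_cancel_left:
  assumes "x \<in> carrier G" "y \<in> carrier G"
  shows "inv x \<otimes> (x \<otimes> y) = y" and "x \<otimes> (inv x \<otimes> y) = y"
  using assms by (simp_all add: m_assoc[symmetric])

lemma mem_conj_subgroup_iff:
  assumes "subgroup H G" "g \<in> carrier G"
  shows "y \<in> conj_subgroup G H g \<longleftrightarrow> y \<in> carrier G \<and> g \<otimes> y \<otimes> inv g \<in> H"
proof
  interpret H: subgroup H G by fact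
  show "y \<in> carrier G \<and> g \<otimes> y \<otimes> inv g \<in> H" if y: "y \<in> conj_subgroup G H g"
  proof -
    obtain h where h: "h \<in> H" "y = inv g \<otimes> h \<otimes> g"
      using y by (auto simp: conj_subgroup_def l_coset_def r_coset_def)
    have "g \<otimes> y \<otimes> inv g = h"
      using h assms(2) by (simp add: m_assoc) (simp add: m_assoc[symmetric])
    then show ?thesis using h assms(2) by simp
  qed
  show "y \<in> conj_subgroup G H g" if y: "y \<in> carrier G \<and> g \<otimes> y \<otimes> inv g \<in> H"
  proof -
    have "y = inv g \<otimes> (g \<otimes> y \<otimes> inv g) \<otimes> g"
      using y assms(2) by (simp add: m_assoc) (simp add: m_assoc[symmetric])
    then show ?thesis
      using y unfolding conj_subgroup_def l_coset_def r_coset_def by blast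
  qed
qed

lemma subgroup_conj_subgroup:
  assumes "subgroup H G" "g \<in> carrier G"
  shows "subgroup (conj_subgroup G H g) G"
proof -
  interpret H: subgroup H G by fact
  show ?thesis
  proof (rule subgroupI)
    show "conj_subgroup G H g \<subseteq> carrier G" using mem_conj_subgroup_iff[OF assms] by blast
    have "\<one> \<in> conj_subgroup G H g" using assms by (simp add: mem_conj_subgroup_iff)
    then show "conj_subgroup G H g \<noteq> {}" by blast
  next
    fix a assume a: "a \<in> conj_subgroup G H g"
    then have "inv (g \<otimes> a \<otimes> inv g) \<in> H" using assms by (simp add: mem_conj_subgroup_iff)
    moreover have "inv (g \<otimes> a \<otimes> inv g) = g \<otimes> inv a \<otimes> inv g"
      using a assms by (simp add: mem_conj_subgroup_iff inv_mult_group m_assoc)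
    ultimately show "inv a \<in> conj_subgroup G H g" using a assms by (simp add: mem_conj_subgroup_iff)
  next
    fix a b assume ab: "a \<in> conj_subgroup G H g" "b \<in> conj_subgroup G H g"
    then have "(g \<otimes> a \<otimes> inv g) \<otimes> (g \<otimes> b \<otimes> inv g) \<in> H"
      using assms by (simp add: mem_conj_subgroup_iff)
    moreover have "(g \<otimes> a \<otimes> inv g) \<otimes> (g \<otimes> b \<otimes> inv g) = g \<otimes> (a \<otimes> b) \<otimes> inv g"
      using ab assms by (simp add: mem_conj_subgroup_iff m_assoc mult_inv_cancel_left)
    ultimately show "a \<otimes> b \<in> conj_subgroup G H g" using ab assms by (simp add: mem_conj_subgroup_iff)
  qed
qed

text \<open>
  Finite index is stated through a finite set \<open>F\<close> of elements of the larger group that meets each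
  left coset of the smaller one; \<open>F\<close> may contain several elements of the same coset.
\<close>

lemma proximate_normalD:
  assumes prox: "proximate_normal H G" and g: "g \<in> carrier G"
  shows "\<And>h k. h \<in> H \<Longrightarrow> k \<in> H \<inter> conj_subgroup G H g \<Longrightarrow>
      inv h \<otimes> k \<otimes> h \<in> H \<inter> conj_subgroup G H g"
    and "\<exists>F. finite F \<and> F \<subseteq> H \<and> (\<forall>h\<in>H. \<exists>f\<in>F. inv f \<otimes> h \<in> H \<inter> conj_subgroup G H g)"
proof -
  let ?K = "H \<inter> conj_subgroup G H g" and ?GH = "G\<lparr>carrier := H\<rparr>"
  have H: "subgroup H G" and n: "?K \<lhd> ?GH" and fin: "finite (rcosets\<^bsub>?GH\<^esub> ?K)"
    using prox g by (auto simp: proximate_normal_def Let_def)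
  interpret H: subgroup H G by fact
  interpret N: normal ?K ?GH by fact
  show conj: "inv h \<otimes> k \<otimes> h \<in> ?K" if "h \<in> H" "k \<in> ?K" for h k
    using N.inv_op_closed1[of h k] that H by (simp add: m_inv_consistent)
  let ?F = "(\<lambda>C. SOME h. h \<in> H \<and> C = ?K #>\<^bsub>?GH\<^esub> h) ` (rcosets\<^bsub>?GH\<^esub> ?K)"
  have some: "(SOME h. h \<in> H \<and> C = ?K #>\<^bsub>?GH\<^esub> h) \<in> H \<and> C = ?K #>\<^bsub>?GH\<^esub> (SOME h. h \<in> H \<and> C = ?K #>\<^bsub>?GH\<^esub> h)"
    if "C \<in> rcosets\<^bsub>?GH\<^esub> ?K" for C
  proof (rule someI_ex)
    show "\<exists>h. h \<in> H \<and> C = ?K #>\<^bsub>?GH\<^esub> h" using that by (auto simp: RCOSETS_def)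
  qed
  have "\<exists>f\<in>?F. inv f \<otimes> h \<in> ?K" if h: "h \<in> H" for h
  proof -
    let ?C = "?K #>\<^bsub>?GH\<^esub> h"
    let ?f = "SOME f. f \<in> H \<and> ?C = ?K #>\<^bsub>?GH\<^esub> f"
    have C: "?C \<in> rcosets\<^bsub>?GH\<^esub> ?K" using h by (auto simp: RCOSETS_def)
    have f: "?f \<in> H" "?C = ?K #>\<^bsub>?GH\<^esub> ?f" using some[OF C] by auto
    have "h \<in> ?C" using N.is_subgroup group.rcos_self[OF H.subgroup_is_group[OF group_axioms], of h ?K] h by simp
    then have "h \<in> ?K #>\<^bsub>?GH\<^esub> ?f" using f(2) by (rule back_subst)
    then obtain k where k: "k \<in> ?K" "h = k \<otimes> ?f" by (auto simp: r_coset_def)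
    have "inv ?f \<otimes> h = inv ?f \<otimes> k \<otimes> ?f" using k f by (simp add: m_assoc)
    then have "inv ?f \<otimes> h \<in> ?K" using conj[OF f(1) k(1)] by simp
    then show ?thesis using C by blast
  qed
  then show "\<exists>F. finite F \<and> F \<subseteq> H \<and> (\<forall>h\<in>H. \<exists>f\<in>F. inv f \<otimes> h \<in> ?K)"
    using fin some by (intro exI[of _ ?F]) auto
qed

text \<open>
  Conjugation by \<open>g\<close> maps the pair \<open>H \<inter> H\<^sup>g \<le> H\<^sup>g\<close> to the pair \<open>H \<inter> H\<^sup>g\<^sup>' \<le> H\<close>, where
  \<open>g' = g\<^sup>-\<^sup>1\<close>.  Hence \<open>H \<inter> H\<^sup>g\<close> is normal of finite index in \<open>H\<^sup>g\<close> as well.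
\<close>

lemma proximate_normal_conjD:
  assumes prox: "proximate_normal H G" and g: "g \<in> carrier G"
  shows "\<And>l k. l \<in> conj_subgroup G H g \<Longrightarrow> k \<in> H \<inter> conj_subgroup G H g \<Longrightarrow>
      inv l \<otimes> k \<otimes> l \<in> H \<inter> conj_subgroup G H g"
    and "\<exists>F. finite F \<and> F \<subseteq> conj_subgroup G H g \<and>
      (\<forall>l\<in>conj_subgroup G H g. \<exists>f\<in>F. inv f \<otimes> l \<in> H \<inter> conj_subgroup G H g)"
proof -
  have H: "subgroup H G" using prox by (simp add: proximate_normal_def)
  interpret H: subgroup H G by fact
  let ?L = "conj_subgroup G H g" and ?K' = "H \<inter> conj_subgroup G H (inv g)"
  let ?c = "\<lambda>y. g \<otimes> y \<otimes> inv g" and ?d = "\<lambda>y. inv g \<otimes> y \<otimes> g"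
  have cd: "?c (?d y) = y" and dc: "?d (?c y) = y" if "y \<in> carrier G" for y
    using that g by (simp add: m_assoc, simp add: m_assoc[symmetric])+
  have c_mult: "?c (y \<otimes> z) = ?c y \<otimes> ?c z" if "y \<in> carrier G" "z \<in> carrier G" for y z
  proof -
    show ?thesis using that g by (simp add: m_assoc mult_inv_cancel_left)
  qed
  have c_inv: "?c (inv y) = inv (?c y)" if "y \<in> carrier G" for y
    using that g by (simp add: inv_mult_group m_assoc)
  have L: "y \<in> ?L \<longleftrightarrow> y \<in> carrier G \<and> ?c y \<in> H" for y
    using H g by (rule mem_conj_subgroup_iff)
  have K': "?c y \<in> ?K' \<longleftrightarrow> y \<in> H \<inter> ?L" if "y \<in> carrier G" for y
    using that g dc[OF that] mem_conj_subgroup_iff[OF H, of "inv g" "?c y"] L by auto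
  interpret L: subgroup ?L G by (rule subgroup_conj_subgroup[OF H g])
  show "inv l \<otimes> k \<otimes> l \<in> H \<inter> ?L" if l: "l \<in> ?L" and k: "k \<in> H \<inter> ?L" for l k
  proof -
    have lk: "l \<in> carrier G" "inv l \<in> carrier G" "k \<in> carrier G" using l k by auto
    have "?c l \<in> H" "?c k \<in> ?K'" using l k L K' lk by blast+
    then have "inv (?c l) \<otimes> ?c k \<otimes> ?c l \<in> ?K'"
      by (rule proximate_normalD(1)[OF prox inv_closed[OF g]])
    moreover have "inv (?c l) \<otimes> ?c k \<otimes> ?c l = ?c (inv l \<otimes> k \<otimes> l)"
      using lk by (simp only: c_mult c_inv m_closed)
    ultimately show ?thesis using K'[of "inv l \<otimes> k \<otimes> l"] l k by simp
  qed
  obtain F where F: "finite F" "F \<subseteq> H" "\<And>h. h \<in> H \<Longrightarrow> \<exists>f\<in>F. inv f \<otimes> h \<in> ?K'"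
    using proximate_normalD(2)[OF prox inv_closed[OF g]] by blast
  show "\<exists>F. finite F \<and> F \<subseteq> ?L \<and> (\<forall>l\<in>?L. \<exists>f\<in>F. inv f \<otimes> l \<in> H \<inter> ?L)"
  proof (intro exI[of _ "?d ` F"] conjI ballI)
    show "finite (?d ` F)" using F by simp
    show "?d ` F \<subseteq> ?L"
    proof
      fix y assume "y \<in> ?d ` F"
      then obtain f where f: "f \<in> H" "y = ?d f" using F(2) by blast
      then have "?c y = f" using cd[of f] by simp
      then show "y \<in> ?L" using L[of y] f g by simp
    qed
  next
    fix l assume l: "l \<in> ?L"
    obtain f where f: "f \<in> F" "inv f \<otimes> ?c l \<in> ?K'" using F(3)[of "?c l"] l L by blast
    have "f \<in> H" using f F(2) by blast
    then have fc: "f \<in> carrier G" "?d f \<in> carrier G" using g by simp_all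
    have lc: "l \<in> carrier G" using l by simp
    have "?c (inv (?d f) \<otimes> l) = inv (?c (?d f)) \<otimes> ?c l"
      using fc lc by (simp only: c_mult c_inv inv_closed)
    then have "?c (inv (?d f) \<otimes> l) = inv f \<otimes> ?c l" by (simp only: cd fc)
    then have "?c (inv (?d f) \<otimes> l) \<in> ?K'" using f(2) by (simp only:)
    then have "inv (?d f) \<otimes> l \<in> H \<inter> ?L"
      using K'[of "inv (?d f) \<otimes> l"] fc(2) lc by (simp only: m_closed inv_closed)
    then show "\<exists>f\<in>?d ` F. inv f \<otimes> l \<in> H \<inter> ?L" using f by blast
  qed
qed

end

section \<open>The induced representation restricted to the subgroup\<close>

text \<open>
  The representation induced from an irreducible representation \<open>\<rho>\<close> of \<open>H\<close> on \<open>W\<close>; the induced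
  space is written \<open>I\<close> and the action on it \<open>\<pi>\<close>.
\<close>

locale induced_from_irreducible =
  G: group G + H: subgroup H G + W: irreducible_representation "G\<lparr>carrier := H\<rparr>" scale W \<rho>
  for G :: "('g, 'm) monoid_scheme" (structure)
    and H :: "'g set"
    and scale :: "complex \<Rightarrow> 'w::ab_group_add \<Rightarrow> 'w"
    and W :: "'w set"
    and \<rho> :: "'g \<Rightarrow> 'w \<Rightarrow> 'w"
begin

abbreviation "I \<equiv> ind_space G H W \<rho>"
abbreviation "\<pi> \<equiv> ind_action G H W \<rho>"

sublocale Ind: representation G "pointwise_scale scale" I \<pi>
  using representation_ind G.group_axioms H.subgroup_axioms W.representation_axioms by blast

lemma act_apply: "f \<in> I \<Longrightarrow> \<pi> g f x = (if x \<in> carrier G then f (x \<otimes> g) else 0)"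
  by (simp add: ind_action_def)

lemma equivariant: "f \<in> I \<Longrightarrow> h \<in> H \<Longrightarrow> x \<in> carrier G \<Longrightarrow> f (h \<otimes> x) = \<rho> h (f x)"
  by (simp add: ind_space_def)

lemma value_in: "f \<in> I \<Longrightarrow> x \<in> carrier G \<Longrightarrow> f x \<in> W"
  by (simp add: ind_space_def)

lemma outside: "f \<in> I \<Longrightarrow> x \<notin> carrier G \<Longrightarrow> f x = 0"
  by (simp add: ind_space_def)

lemma rho_zero: "h \<in> H \<Longrightarrow> \<rho> h 0 = 0"
  using W.action_zero[of h] by simp

text \<open>The functions in the induced space that vanish outside \<open>C\<close>.\<close>

definition supported :: "'g set \<Rightarrow> ('g \<Rightarrow> 'w) set"
  where "supported C = {f \<in> I. \<forall>x. f x \<noteq> 0 \<longrightarrow> x \<in> C}"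

text \<open>The unions of right cosets of \<open>H\<close>: functions may be cut off outside such a set.\<close>

definition left_stable :: "'g set \<Rightarrow> bool"
  where "left_stable C \<longleftrightarrow> C \<subseteq> carrier G \<and> (\<forall>h\<in>H. \<forall>x\<in>C. h \<otimes> x \<in> C)"

lemma subspace_supported: "Ind.subspace (supported C)"
proof (rule Ind.subspaceI)
  show "0 \<in> supported C"
    using Ind.subspace_0[OF Ind.subspace_space] by (simp add: supported_def)
next
  fix f f' assume ff': "f \<in> supported C" "f' \<in> supported C"
  have "x \<in> C" if "f x + f' x \<noteq> 0" for x
  proof (rule ccontr)
    assume "x \<notin> C"
    then have "f x = 0" "f' x = 0" using ff' by (auto simp: supported_def)
    then show False using that by simp
  qed
  with ff' show "f + f' \<in> supported C"
    using Ind.subspace_add[OF Ind.subspace_space] by (auto simp: supported_def)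
next
  fix c f assume f: "f \<in> supported C"
  have "x \<in> C" if "scale c (f x) \<noteq> 0" for x
    using f that by (auto simp: supported_def)
  with f show "pointwise_scale scale c f \<in> supported C"
    using Ind.subspace_scale[OF Ind.subspace_space, of f c]
    by (auto simp: supported_def pointwise_scale_def)
qed

lemma supported_subset: "supported C \<subseteq> I"
  by (auto simp: supported_def)

lemma supported_mono: "C \<subseteq> D \<Longrightarrow> supported C \<subseteq> supported D"
  by (auto simp: supported_def)

lemma act_supported:
  assumes g: "g \<in> carrier G" and f: "f \<in> supported C"
    and CD: "\<And>x. x \<in> carrier G \<Longrightarrow> x \<otimes> g \<in> C \<Longrightarrow> x \<in> D"
  shows "\<pi> g f \<in> supported D"
  using assms Ind.action_closed[OF g] by (auto simp: supported_def act_apply split: if_splits)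

lemma invariant_supported:
  assumes "K \<subseteq> carrier G" "\<And>x k. k \<in> K \<Longrightarrow> x \<in> carrier G \<Longrightarrow> x \<otimes> k \<in> C \<Longrightarrow> x \<in> C"
  shows "Ind.invariant K (supported C)"
  unfolding Ind.invariant_def
  using assms by (intro conjI ballI subspace_supported supported_subset act_supported[of _ _ C C]) auto

lemma restrict_supported:
  assumes f: "f \<in> I" and C: "left_stable C"
  shows "(\<lambda>x. if x \<in> C then f x else 0) \<in> supported C"
proof -
  have hC: "h \<otimes> x \<in> C \<longleftrightarrow> x \<in> C" if "h \<in> H" "x \<in> carrier G" for h x
  proof
    assume "h \<otimes> x \<in> C"
    then have "inv h \<otimes> (h \<otimes> x) \<in> C" using C that by (auto simp: left_stable_def)
    then show "x \<in> C" using that by (simp add: G.m_assoc[symmetric])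
  qed (use C that in \<open>auto simp: left_stable_def\<close>)
  obtain D where D: "D \<subseteq> rcosets H" "finite D" "{x. f x \<noteq> 0} \<subseteq> \<Union>D"
    using f by (auto simp: ind_space_def)
  have "\<exists>D\<subseteq>rcosets H. finite D \<and> {x. (if x \<in> C then f x else 0) \<noteq> 0} \<subseteq> \<Union>D"
    by (intro exI[of _ D] conjI D) (use D(3) in auto)
  then show ?thesis
    using f W.subspace_0[OF W.subspace_space]
    by (auto simp: supported_def ind_space_def hC rho_zero)
qed

lemma split_supported:
  assumes f: "f \<in> supported (C \<union> D)" and C: "left_stable C" and D: "left_stable D"
  shows "\<exists>a\<in>supported C. \<exists>b\<in>supported D. f = a + b"
proof -
  have fI: "f \<in> I" using f supported_subset by blast
  have "left_stable (D - C)"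
    unfolding left_stable_def
  proof (intro conjI ballI)
    show "D - C \<subseteq> carrier G" using D by (auto simp: left_stable_def)
    fix h x assume h: "h \<in> H" and x: "x \<in> D - C"
    have xc: "x \<in> carrier G" using x D by (auto simp: left_stable_def)
    have "h \<otimes> x \<notin> C"
    proof
      assume "h \<otimes> x \<in> C"
      then have "inv h \<otimes> (h \<otimes> x) \<in> C" using C h by (auto simp: left_stable_def)
      then show False using h xc x by (simp add: G.m_assoc[symmetric])
    qed
    then show "h \<otimes> x \<in> D - C" using h x D by (auto simp: left_stable_def)
  qed
  then have b: "(\<lambda>x. if x \<in> D - C then f x else 0) \<in> supported D"
    using restrict_supported[OF fI] supported_mono[of "D - C" D] by blast
  have a: "(\<lambda>x. if x \<in> C then f x else 0) \<in> supported C"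
    using restrict_supported[OF fI C] .
  have "f = (\<lambda>x. if x \<in> C then f x else 0) + (\<lambda>x. if x \<in> D - C then f x else 0)"
    using f by (auto simp: fun_eq_iff supported_def)
  then show ?thesis using a b by blast
qed

lemma complemented_supported_Union:
  assumes "finite \<C>" and K: "K \<subseteq> carrier G"
    and "\<And>C. C \<in> \<C> \<Longrightarrow> left_stable C \<and> Ind.invariant K (supported C) \<and> Ind.complemented K (supported C)"
    and "Ind.invariant K (supported (\<Union>\<C>))"
  shows "Ind.complemented K (supported (\<Union>\<C>))"
proof -
  have "left_stable (\<Union>\<C>) \<and> Ind.invariant K (supported (\<Union>\<C>)) \<and> Ind.complemented K (supported (\<Union>\<C>))"
    using assms(1,3)
  proof (induction \<C>)
    case empty
    have "supported {} = {0}"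
      using Ind.subspace_0[OF Ind.subspace_space] by (auto simp: supported_def fun_eq_iff)
    then show ?case
      using Ind.complemented_zero Ind.invariant_zero K by (simp add: left_stable_def)
  next
    case (insert C \<C>)
    let ?D = "\<Union>\<C>"
    have C: "left_stable C" "Ind.invariant K (supported C)" "Ind.complemented K (supported C)"
      and D: "left_stable ?D" "Ind.invariant K (supported ?D)" "Ind.complemented K (supported ?D)"
      using insert by auto
    have le: "supported C \<subseteq> supported (C \<union> ?D)" "supported ?D \<subseteq> supported (C \<union> ?D)"
      by (auto intro!: supported_mono)
    have "Ind.invariant K {a + b | a b. a \<in> supported C \<and> b \<in> supported ?D}"
      using Ind.invariant_plus C D K by blast
    moreover have "{a + b | a b. a \<in> supported C \<and> b \<in> supported ?D} = supported (C \<union> ?D)"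
    proof
      show "{a + b | a b. a \<in> supported C \<and> b \<in> supported ?D} \<subseteq> supported (C \<union> ?D)"
        using le Ind.subspace_add[OF subspace_supported] by blast
      show "supported (C \<union> ?D) \<subseteq> {a + b | a b. a \<in> supported C \<and> b \<in> supported ?D}"
        using split_supported C(1) D(1) by blast
    qed
    ultimately have inv: "Ind.invariant K (supported (C \<union> ?D))" by simp
    have "Ind.complemented K (supported (C \<union> ?D))"
      by (rule Ind.complemented_sum[OF K C(2,3) le(1) D(2,3) le(2) inv])
        (rule split_supported[OF _ C(1) D(1)])
    moreover have "left_stable (C \<union> ?D)" using C(1) D(1) by (auto simp: left_stable_def)
    ultimately show ?case using inv by simp
  qed
  then show ?thesis by blast
qed

lemma left_stable_Union: "(\<And>C. C \<in> \<C> \<Longrightarrow> left_stable C) \<Longrightarrow> left_stable (\<Union>\<C>)"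
  unfolding left_stable_def by blast

lemma left_stable_rcoset: "x \<in> carrier G \<Longrightarrow> left_stable (H #> x)"
  by (auto simp: left_stable_def r_coset_def) (metis G.m_assoc H.m_closed H.mem_carrier)

lemma invariant_supported_rcoset:
  assumes x: "x \<in> carrier G"
  shows "Ind.invariant (conj_subgroup G H x) (supported (H #> x))"
proof (rule invariant_supported)
  show "conj_subgroup G H x \<subseteq> carrier G"
    using G.subgroup_conj_subgroup[OF H.subgroup_axioms x] subgroup.subset by blast
next
  fix y k assume k: "k \<in> conj_subgroup G H x" and y: "y \<in> carrier G" and yk: "y \<otimes> k \<in> H #> x"
  have kc: "k \<in> carrier G" "x \<otimes> k \<otimes> inv x \<in> H"
    using k G.mem_conj_subgroup_iff[OF H.subgroup_axioms x] by auto
  obtain h where h: "h \<in> H" "y \<otimes> k = h \<otimes> x" using yk by (auto simp: r_coset_def)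
  have "y = y \<otimes> k \<otimes> inv k" using y kc by (simp add: G.m_assoc)
  also have "\<dots> = h \<otimes> x \<otimes> inv k" using h by simp
  also have "\<dots> = (h \<otimes> inv (x \<otimes> k \<otimes> inv x)) \<otimes> x"
    using h kc x by (simp add: G.inv_mult_group G.m_assoc)
  finally show "y \<in> H #> x" using h kc by (auto simp: r_coset_def)
qed

text \<open>
  Evaluation at \<open>x\<close> intertwines the action of \<open>H\<^sup>x\<close> with the conjugate of \<open>\<rho>\<close> by \<open>x\<close>.
\<close>

lemma eval_image:
  assumes x: "x \<in> carrier G" and U: "Ind.invariant (conj_subgroup G H x) U"
  shows "(\<lambda>f. f x) ` U = {0} \<or> (\<lambda>f. f x) ` U = W"
proof (rule W.no_proper_invariant)
  let ?U = "(\<lambda>f. f x) ` U"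
  have UI: "U \<subseteq> I" using U Ind.invariant_subset by blast
  have sU: "Ind.subspace U" using U Ind.invariant_subspace by blast
  show "W.subspace ?U"
  proof (rule W.subspaceI)
    have "(0 :: 'g \<Rightarrow> 'w) x \<in> ?U" using Ind.subspace_0[OF sU] by (rule imageI)
    then show "0 \<in> ?U" by simp
  next
    fix v w assume "v \<in> ?U" "w \<in> ?U"
    then obtain f f' where "f \<in> U" "f' \<in> U" "v = f x" "w = f' x" by blast
    moreover from this have "(f + f') x \<in> ?U" using Ind.subspace_add[OF sU] by (intro imageI)
    ultimately show "v + w \<in> ?U" by simp
  next
    fix c v assume "v \<in> ?U"
    then obtain f where "f \<in> U" "v = f x" by blast
    moreover from this have "pointwise_scale scale c f x \<in> ?U"
      using Ind.subspace_scale[OF sU] by (intro imageI)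
    ultimately show "scale c v \<in> ?U" by (simp add: pointwise_scale_def)
  qed
  show "?U \<subseteq> W" using UI x value_in by blast
  fix h u assume "h \<in> carrier (G\<lparr>carrier := H\<rparr>)" "u \<in> ?U"
  then obtain f where h: "h \<in> H" and f: "f \<in> U" "u = f x" by auto
  let ?k = "inv x \<otimes> h \<otimes> x"
  have xk: "x \<otimes> ?k = h \<otimes> x" using x h by (simp add: G.m_assoc[symmetric])
  then have "x \<otimes> ?k \<otimes> inv x = h" using x h by (simp add: G.m_assoc)
  then have "?k \<in> conj_subgroup G H x"
    using x h G.mem_conj_subgroup_iff[OF H.subgroup_axioms x] by simp
  then have "\<pi> ?k f \<in> U" using U f Ind.invariant_act by blast
  moreover have "\<pi> ?k f x = \<rho> h u"
  proof -
    have "f \<in> I" using f UI by blast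
    then have "\<pi> ?k f x = f (h \<otimes> x)" using x xk by (simp add: act_apply)
    then show ?thesis using f \<open>f \<in> I\<close> x h equivariant by simp
  qed
  ultimately show "\<rho> h u \<in> ?U" by (metis imageI)
qed

lemma irreducible_supported_rcoset:
  assumes x: "x \<in> carrier G"
    and U: "Ind.invariant (conj_subgroup G H x) U" "U \<subseteq> supported (H #> x)"
  shows "U = {0} \<or> U = supported (H #> x)"
proof -
  let ?U = "(\<lambda>f. f x) ` U"
  have sU: "Ind.subspace U" using U Ind.invariant_subspace by blast
  have det: "f = f'" if "f \<in> supported (H #> x)" "f' \<in> supported (H #> x)" "f x = f' x" for f f'
  proof
    fix y
    show "f y = f' y"
    proof (cases "y \<in> H #> x")
      case True
      then obtain h where "h \<in> H" "y = h \<otimes> x" by (auto simp: r_coset_def)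
      then show ?thesis using that x by (auto simp: equivariant supported_def)
    next
      case False
      then have "f y = 0" "f' y = 0" using that by (auto simp: supported_def)
      then show ?thesis by simp
    qed
  qed
  from eval_image[OF x U(1)] show ?thesis
  proof
    assume 0: "?U = {0}"
    have "f = 0" if f: "f \<in> U" for f
    proof (rule det)
      show "f \<in> supported (H #> x)" using f U(2) by blast
      show "0 \<in> supported (H #> x)" by (rule Ind.subspace_0[OF subspace_supported])
      have "f x \<in> {0}" using f 0 by blast
      then show "f x = (0 :: 'g \<Rightarrow> 'w) x" by simp
    qed
    then show ?thesis using Ind.subspace_0[OF sU] by blast
  next
    assume W: "?U = W"
    have "f \<in> U" if f: "f \<in> supported (H #> x)" for f
    proof -
      have "f x \<in> ?U" using W f value_in x supported_subset by blast
      then obtain u where "u \<in> U" "f x = u x" by blast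
      then show ?thesis using det[OF f, of u] U(2) by blast
    qed
    then show ?thesis using U(2) by blast
  qed
qed

section \<open>Frobenius reciprocity\<close>

text \<open>
  An \<open>H\<close>-map \<open>s\<close> from \<open>W\<close> to the induced representation extends to the endomorphism
  \<open>f \<mapsto> \<Sum> \<pi>(x\<^sup>-\<^sup>1) s(f(x))\<close>, with \<open>x\<close> ranging over representatives of the right
  cosets of \<open>H\<close>.
\<close>

lemma frobenius_extension:
  assumes s_in: "\<And>w. w \<in> W \<Longrightarrow> s w \<in> I"
    and s_add: "\<And>v w. v \<in> W \<Longrightarrow> w \<in> W \<Longrightarrow> s (v + w) = s v + s w"
    and s_scale: "\<And>c w. w \<in> W \<Longrightarrow> s (scale c w) = pointwise_scale scale c (s w)"
    and s_act: "\<And>h w. h \<in> H \<Longrightarrow> w \<in> W \<Longrightarrow> s (\<rho> h w) = \<pi> h (s w)"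
  obtains T where "T \<in> endomorphisms G (pointwise_scale scale) I \<pi>"
    "\<And>f. f \<in> supported H \<Longrightarrow> T f = s (f \<one>)"
proof -
  \<comment> \<open>The summand depends only on the right coset of \<open>x\<close>, and \<open>S f\<close> is the finite set of cosets
    on which \<open>f\<close> does not vanish.\<close>
  define t where "t x f = \<pi> (inv x) (s (f x))" for x f
  define r where "r C = (SOME x. x \<in> carrier G \<and> C = H #> x)" for C
  define S where "S f = {C \<in> rcosets H. f (r C) \<noteq> 0}" for f :: "'g \<Rightarrow> 'w"
  define T where "T f = (if f \<in> I then \<Sum>C\<in>S f. t (r C) f else 0)" for f
  have s0: "s 0 = 0"
    using s_scale[of 0 0] W.subspace_0[OF W.subspace_space] by simp
  have r: "r C \<in> carrier G" "C = H #> r C" if "C \<in> rcosets H" for C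
  proof -
    have "\<exists>x. x \<in> carrier G \<and> C = H #> x" using that by (auto simp: RCOSETS_def)
    from someI_ex[OF this] show "r C \<in> carrier G" "C = H #> r C" by (auto simp: r_def)
  qed
  have rep: "\<exists>h\<in>H. x = h \<otimes> r C" if "C \<in> rcosets H" "x \<in> C" for C x
    using that r(2)[OF that(1)] by (auto simp: r_coset_def)
  have t_in: "t x f \<in> I" if "x \<in> carrier G" "f \<in> I" for x f
    unfolding t_def by (intro Ind.action_closed s_in value_in G.inv_closed that)
  have t_coset: "t (h \<otimes> x) f = t x f" if "h \<in> H" "x \<in> carrier G" "f \<in> I" for h x f
  proof -
    have w: "f x \<in> W" using that value_in by blast
    have "t (h \<otimes> x) f = \<pi> (inv (h \<otimes> x)) (\<pi> h (s (f x)))"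
      using that w by (simp add: t_def equivariant s_act)
    also have "\<dots> = \<pi> (inv (h \<otimes> x) \<otimes> h) (s (f x))"
      using that w s_in by (intro Ind.composition_rule[symmetric]) auto
    also have "inv (h \<otimes> x) \<otimes> h = inv x"
      using that by (simp add: G.inv_mult_group G.m_assoc)
    finally show ?thesis by (simp add: t_def)
  qed
  have t_rep: "t (r C) f = t x f" if "C \<in> rcosets H" "x \<in> C" "f \<in> I" for C x f
    using rep[OF that(1,2)] t_coset[OF _ r(1)[OF that(1)] that(3)] by auto
  have nz_rep: "f (r C) \<noteq> 0 \<longleftrightarrow> f x \<noteq> 0" if C: "C \<in> rcosets H" "x \<in> C" and f: "f \<in> I" for C x f
  proof -
    obtain h where h: "h \<in> H" "x = h \<otimes> r C" using rep[OF C] by blast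
    have rC: "r C \<in> carrier G" using r C by blast
    have "f x = \<rho> h (f (r C))" using h rC f equivariant by simp
    moreover have "f (r C) = \<rho> (inv h) (f x)"
    proof -
      have "inv h \<otimes> x = r C" using h rC by (simp add: G.m_assoc[symmetric])
      then show ?thesis using equivariant[OF f, of "inv h" x] h rC by simp
    qed
    ultimately show ?thesis using rho_zero h by (metis H.m_inv_closed)
  qed
  have finS: "finite (S f)" if f: "f \<in> I" for f
  proof -
    obtain D where D: "D \<subseteq> rcosets H" "finite D" "{x. f x \<noteq> 0} \<subseteq> \<Union>D"
      using f by (auto simp: ind_space_def)
    have "S f \<subseteq> D"
    proof
      fix C assume C: "C \<in> S f"
      then have "r C \<in> \<Union>D" using D by (auto simp: S_def)
      then obtain C' where C': "C' \<in> D" "r C \<in> C'" by blast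
      obtain x where x: "x \<in> carrier G" "C' = H #> x" using C' D by (auto simp: RCOSETS_def)
      have "C' = H #> r C"
        using G.repr_independence[of "r C" H x] C' x H.subgroup_axioms by simp
      also have "\<dots> = C" using r(2)[of C] C by (simp add: S_def)
      finally show "C \<in> D" using C' by simp
    qed
    then show ?thesis using D(2) finite_subset by blast
  qed
  have t_zero: "t x f = 0" if "x \<in> carrier G" "f x = 0" for x f
    using that by (simp add: t_def s0 Ind.action_zero)
  have T_eq: "T f = (\<Sum>C\<in>A. t (r C) f)"
    if f: "f \<in> I" and A: "finite A" "A \<subseteq> rcosets H" "S f \<subseteq> A" for f A
  proof -
    have "(\<Sum>C\<in>S f. t (r C) f) = (\<Sum>C\<in>A. t (r C) f)"
    proof (rule sum.mono_neutral_left)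
      show "\<forall>C\<in>A - S f. t (r C) f = 0"
      proof
        fix C assume "C \<in> A - S f"
        then have "C \<in> rcosets H" "f (r C) = 0" using A by (auto simp: S_def)
        then show "t (r C) f = 0" using t_zero r by blast
      qed
    qed (use A in auto)
    then show ?thesis using f by (simp add: T_def)
  qed
  have T_in: "T f \<in> I" if f: "f \<in> I" for f
    using f t_in r by (auto simp: T_def S_def intro!: Ind.subspace_sum[OF Ind.subspace_space])
  have "T (f + f') = T f + T f'" if f: "f \<in> I" and f': "f' \<in> I" for f f'
  proof -
    let ?A = "S f \<union> S f'"
    have A: "finite ?A" "?A \<subseteq> rcosets H" using finS f f' by (auto simp: S_def)
    have ff': "f + f' \<in> I" using f f' Ind.subspace_add[OF Ind.subspace_space] by blast
    have "T (f + f') = (\<Sum>C\<in>?A. t (r C) (f + f'))"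
      by (rule T_eq[OF ff' A]) (auto simp: S_def)
    also have "\<dots> = (\<Sum>C\<in>?A. t (r C) f + t (r C) f')"
    proof (rule sum.cong)
      fix C assume "C \<in> ?A"
      then have rC: "r C \<in> carrier G" using A r by blast
      then show "t (r C) (f + f') = t (r C) f + t (r C) f'"
        using f f' value_in s_in by (simp add: t_def s_add Ind.action_add)
    qed simp
    also have "\<dots> = T f + T f'"
      using T_eq[OF f A] T_eq[OF f' A] by (simp add: sum.distrib)
    finally show ?thesis .
  qed
  moreover have "T (pointwise_scale scale c f) = pointwise_scale scale c (T f)" if f: "f \<in> I" for c f
  proof -
    have A: "finite (S f)" "S f \<subseteq> rcosets H" using finS f by (auto simp: S_def)
    have cf: "pointwise_scale scale c f \<in> I"
      using f Ind.subspace_scale[OF Ind.subspace_space] by blast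
    have "T (pointwise_scale scale c f) = (\<Sum>C\<in>S f. t (r C) (pointwise_scale scale c f))"
      by (rule T_eq[OF cf A]) (auto simp: S_def pointwise_scale_def)
    also have "\<dots> = (\<Sum>C\<in>S f. pointwise_scale scale c (t (r C) f))"
    proof (rule sum.cong)
      fix C assume "C \<in> S f"
      then have rC: "r C \<in> carrier G" using A r by blast
      have "s (pointwise_scale scale c f (r C)) = pointwise_scale scale c (s (f (r C)))"
        using s_scale[of "f (r C)" c] f rC value_in by (simp add: pointwise_scale_def)
      then show "t (r C) (pointwise_scale scale c f) = pointwise_scale scale c (t (r C) f)"
        using f rC value_in s_in by (simp add: t_def Ind.action_scale)
    qed simp
    also have "\<dots> = pointwise_scale scale c (T f)"
      using T_eq[OF f A] by (simp add: Ind.scale_sum_right)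
    finally show ?thesis .
  qed
  moreover have "T (\<pi> g f) = \<pi> g (T f)" if g: "g \<in> carrier G" and f: "f \<in> I" for g f
  proof -
    have gf: "\<pi> g f \<in> I" using Ind.action_closed g f by blast
    have shift: "C #> x \<in> rcosets H" if "C \<in> rcosets H" "x \<in> carrier G" for C x
    proof -
      have "C #> x = H #> (r C \<otimes> x)"
        using r[OF that(1)] that(2) G.coset_mult_assoc[of H "r C" x] H.subset by simp
      then show ?thesis using r[OF that(1)] that(2) by (auto simp: RCOSETS_def)
    qed
    have memC: "r C \<otimes> x \<in> C #> x" if "C \<in> rcosets H" for C x
    proof -
      have "r C \<in> C" using G.rcos_self[OF r(1)[OF that] H.subgroup_axioms] r(2)[OF that] by simp
      then show ?thesis by (auto simp: r_coset_def)
    qed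
    have canc: "C #> x #> y = C" if "C \<in> rcosets H" "x \<in> carrier G" "y \<in> carrier G" "x \<otimes> y = \<one>" for C x y
    proof -
      have "C \<subseteq> carrier G"
        using r[OF that(1)] H.subset G.r_coset_subset_G by metis
      then show ?thesis using that by (simp add: G.coset_mult_assoc)
    qed
    have t_g: "t x (\<pi> g f) = \<pi> g (t (x \<otimes> g) f)" if x: "x \<in> carrier G" for x
    proof -
      have "inv x = g \<otimes> inv (x \<otimes> g)"
        using x g by (simp add: G.inv_mult_group G.m_assoc[symmetric])
      then have "\<pi> (inv x) (s (f (x \<otimes> g))) = \<pi> g (\<pi> (inv (x \<otimes> g)) (s (f (x \<otimes> g))))"
        using x g f s_in value_in by (simp add: Ind.composition_rule)
      then show ?thesis using x f by (simp add: t_def act_apply)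
    qed
    have S_iff: "C #> g \<in> S f \<longleftrightarrow> C \<in> S (\<pi> g f)" if C: "C \<in> rcosets H" for C
      using nz_rep[OF shift[OF C g] memC[OF C] f] f r[OF C] C shift[OF C g]
      by (simp add: S_def act_apply)
    have "T (\<pi> g f) = (\<Sum>C\<in>S (\<pi> g f). t (r C) (\<pi> g f))" using gf by (simp add: T_def)
    also have "\<dots> = (\<Sum>C\<in>S f. \<pi> g (t (r C) f))"
    proof (rule sum.reindex_bij_witness[of _ "\<lambda>C. C #> inv g" "\<lambda>C. C #> g"])
      fix C assume C: "C \<in> S (\<pi> g f)"
      then have CR: "C \<in> rcosets H" by (simp add: S_def)
      show "C #> g #> inv g = C" using canc[OF CR] g by simp
      show "C #> g \<in> S f" using S_iff[OF CR] C by simp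
      show "\<pi> g (t (r (C #> g)) f) = t (r C) (\<pi> g f)"
        using t_rep[OF shift[OF CR g] memC[OF CR] f] t_g[OF r(1)[OF CR]] by simp
    next
      fix C assume C: "C \<in> S f"
      then have CR: "C \<in> rcosets H" by (simp add: S_def)
      show "C #> inv g #> g = C" using canc[OF CR] g by simp
      then show "C #> inv g \<in> S (\<pi> g f)" using S_iff[OF shift[OF CR, of "inv g"]] C g by simp
    qed
    also have "\<dots> = \<pi> g (T f)"
    proof -
      have "\<pi> g (\<Sum>C\<in>S f. t (r C) f) = (\<Sum>C\<in>S f. \<pi> g (t (r C) f))"
      proof (rule Ind.action_sum[OF g])
        show "t (r C) f \<in> I" if "C \<in> S f" for C
          using that t_in r f by (auto simp: S_def)
      qed
      then show ?thesis using f by (simp add: T_def)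
    qed
    finally show ?thesis .
  qed
  ultimately have T: "T \<in> endomorphisms G (pointwise_scale scale) I \<pi>"
    using T_in by (simp add: endomorphisms_def T_def)
  have "T f = s (f \<one>)" if f: "f \<in> supported H" for f
  proof -
    have fI: "f \<in> I" using f supported_subset by blast
    have H: "H \<in> rcosets H" using H.subgroup_in_rcosets G.group_axioms by blast
    have "S f \<subseteq> {H}"
    proof
      fix C assume C: "C \<in> S f"
      then have "r C \<in> H" using f by (auto simp: supported_def S_def)
      then have "H #> r C = H" using G.coset_join2 H.subgroup_axioms H.mem_carrier by blast
      then show "C \<in> {H}" using r(2)[of C] C by (simp add: S_def)
    qed
    then have "T f = (\<Sum>C\<in>{H}. t (r C) f)" by (intro T_eq fI) (use H in auto)
    also have "\<dots> = t \<one> f" using t_rep[OF H H.one_closed fI] by simp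
    also have "\<dots> = s (f \<one>)"
      using fI value_in s_in by (simp add: t_def Ind.action_one)
    finally show ?thesis .
  qed
  with T that show ?thesis by blast
qed

end

section \<open>Semisimplicity over a proximate normal subgroup\<close>

locale induced_from_proximate_normal = induced_from_irreducible G H scale W \<rho>
  for G :: "('g, 'm) monoid_scheme" (structure)
    and H :: "'g set"
    and scale :: "complex \<Rightarrow> 'w::ab_group_add \<Rightarrow> 'w"
    and W :: "'w set"
    and \<rho> :: "'g \<Rightarrow> 'w \<Rightarrow> 'w" +
  assumes proximate: "proximate_normal H G"
begin

abbreviation "conj_sub \<equiv> conj_subgroup G H"

lemma subgroup_Int_conj: "x \<in> carrier G \<Longrightarrow> subgroup (H \<inter> conj_sub x) G"
  using G.subgroup_conj_subgroup[OF H.subgroup_axioms] H.subgroup_axioms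
  by (intro G.subgroups_Inter_pair)

lemma complemented_supported_rcoset:
  assumes x: "x \<in> carrier G"
  shows "Ind.complemented (H \<inter> conj_sub x) (supported (H #> x))"
proof -
  obtain F where F: "finite F" "F \<subseteq> conj_sub x"
      "\<And>l. l \<in> conj_sub x \<Longrightarrow> \<exists>f\<in>F. inv f \<otimes> l \<in> H \<inter> conj_sub x"
    using G.proximate_normal_conjD(2)[OF proximate x] by blast
  show ?thesis
    by (rule Ind.complemented_of_irreducible[OF G.subgroup_conj_subgroup[OF H.subgroup_axioms x]
          subgroup_Int_conj[OF x] Int_lower2 G.proximate_normal_conjD(1)[OF proximate x] F
          invariant_supported_rcoset[OF x] irreducible_supported_rcoset[OF x]])
qed

lemma Int_conj_mult:
  assumes x: "x \<in> carrier G" and h: "h \<in> H"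
  shows "H \<inter> conj_sub (x \<otimes> h) = H \<inter> conj_sub x"
proof -
  have iff: "y \<in> H \<inter> conj_sub (x \<otimes> h) \<longleftrightarrow> h \<otimes> y \<otimes> inv h \<in> H \<inter> conj_sub x" if y: "y \<in> H" for y
  proof -
    have "(x \<otimes> h) \<otimes> y \<otimes> inv (x \<otimes> h) = x \<otimes> (h \<otimes> y \<otimes> inv h) \<otimes> inv x"
      using x h y by (simp add: G.inv_mult_group G.m_assoc)
    then show ?thesis
      using x h y by (simp add: G.mem_conj_subgroup_iff[OF H.subgroup_axioms])
  qed
  have "h \<otimes> y \<otimes> inv h \<in> H \<inter> conj_sub x \<longleftrightarrow> y \<in> H \<inter> conj_sub x" if y: "y \<in> H" for y
  proof
    assume "h \<otimes> y \<otimes> inv h \<in> H \<inter> conj_sub x"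
    then have "inv h \<otimes> (h \<otimes> y \<otimes> inv h) \<otimes> h \<in> H \<inter> conj_sub x"
      by (rule G.proximate_normalD(1)[OF proximate x h])
    moreover have "inv h \<otimes> (h \<otimes> y \<otimes> inv h) \<otimes> h = y"
      using h y by (simp add: G.m_assoc G.mult_inv_cancel_left)
    ultimately show "y \<in> H \<inter> conj_sub x" by simp
  next
    assume "y \<in> H \<inter> conj_sub x"
    then have "inv (inv h) \<otimes> y \<otimes> inv h \<in> H \<inter> conj_sub x"
      by (rule G.proximate_normalD(1)[OF proximate x H.m_inv_closed[OF h]])
    then show "h \<otimes> y \<otimes> inv h \<in> H \<inter> conj_sub x" using h by simp
  qed
  then show ?thesis using iff by blast
qed

text \<open>The double coset \<open>HxH\<close>, as the set of right cosets \<open>Hxh\<close> whose union it is.\<close>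

definition dcoset :: "'g \<Rightarrow> 'g set set"
  where "dcoset x = (\<lambda>h. H #> (x \<otimes> h)) ` H"

lemma finite_dcoset:
  assumes x: "x \<in> carrier G"
  shows "finite (dcoset x)"
proof -
  obtain F where F: "finite F" "F \<subseteq> H" "\<And>h. h \<in> H \<Longrightarrow> \<exists>f\<in>F. inv f \<otimes> h \<in> H \<inter> conj_sub x"
    using G.proximate_normalD(2)[OF proximate x] by blast
  have "dcoset x \<subseteq> (\<lambda>f. H #> (x \<otimes> f)) ` F"
  proof
    fix C assume "C \<in> dcoset x"
    then obtain h where h: "h \<in> H" "C = H #> (x \<otimes> h)" by (auto simp: dcoset_def)
    obtain f where f: "f \<in> F" "inv f \<otimes> h \<in> H \<inter> conj_sub x" using F(3) h by blast
    have fH: "f \<in> H" using f F by blast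
    have "inv (inv f) \<otimes> (inv f \<otimes> h) \<otimes> inv f \<in> H \<inter> conj_sub x"
      by (rule G.proximate_normalD(1)[OF proximate x _ f(2)]) (use fH in simp)
    moreover have "inv (inv f) \<otimes> (inv f \<otimes> h) \<otimes> inv f = h \<otimes> inv f"
      using fH h by (simp add: G.m_assoc[symmetric])
    ultimately have "h \<otimes> inv f \<in> conj_sub x" by simp
    then have k: "x \<otimes> (h \<otimes> inv f) \<otimes> inv x \<in> H"
      using G.mem_conj_subgroup_iff[OF H.subgroup_axioms x] by simp
    have "x \<otimes> h = (x \<otimes> (h \<otimes> inv f) \<otimes> inv x) \<otimes> (x \<otimes> f)"
      using x h fH by (simp add: G.m_assoc G.mult_inv_cancel_left)
    then have "x \<otimes> h \<in> H #> (x \<otimes> f)" using k unfolding r_coset_def by blast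
    then have "H #> (x \<otimes> f) = H #> (x \<otimes> h)"
      using G.repr_independence x fH H.subgroup_axioms by simp
    then show "C \<in> (\<lambda>f. H #> (x \<otimes> f)) ` F" using h f by blast
  qed
  then show ?thesis using F(1) finite_surj by blast
qed

lemma left_stable_dcoset:
  assumes "x \<in> carrier G"
  shows "left_stable (\<Union>(dcoset x))"
proof (rule left_stable_Union)
  fix C assume "C \<in> dcoset x"
  then obtain h where "h \<in> H" "C = H #> (x \<otimes> h)" by (auto simp: dcoset_def)
  then show "left_stable C" using left_stable_rcoset assms by simp
qed

lemma right_stable_dcoset:
  assumes x: "x \<in> carrier G" and k: "k \<in> H" and y: "y \<in> carrier G" and yk: "y \<otimes> k \<in> \<Union>(dcoset x)"
  shows "y \<in> \<Union>(dcoset x)"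
proof -
  obtain h h' where h: "h \<in> H" "h' \<in> H" "y \<otimes> k = h' \<otimes> (x \<otimes> h)"
    using yk by (auto simp: dcoset_def r_coset_def)
  have "y = (y \<otimes> k) \<otimes> inv k" using y k by (simp add: G.m_assoc)
  also have "\<dots> = h' \<otimes> (x \<otimes> (h \<otimes> inv k))" using h x k by (simp add: G.m_assoc)
  finally have "y \<in> H #> (x \<otimes> (h \<otimes> inv k))" using h unfolding r_coset_def by blast
  then show ?thesis using h k by (auto simp: dcoset_def)
qed

text \<open>
  For \<open>h \<in> H\<close> the groups \<open>H \<inter> H\<^sup>x\<^sup>h\<close> and \<open>H \<inter> H\<^sup>x\<close> agree, so that the functions
  supported on \<open>HxH\<close> form a finite sum of semisimple modules over one subgroup of finite index.
\<close>

lemma complemented_supported_dcoset: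
  assumes x: "x \<in> carrier G"
  shows "Ind.complemented H (supported (\<Union>(dcoset x)))"
proof -
  let ?K = "H \<inter> conj_sub x"
  have inv: "Ind.invariant H (supported (\<Union>(dcoset x)))"
    by (rule invariant_supported[OF H.subset]) (rule right_stable_dcoset[OF x])
  have "Ind.complemented ?K (supported (\<Union>(dcoset x)))"
  proof (rule complemented_supported_Union[OF finite_dcoset[OF x]])
    show "?K \<subseteq> carrier G" using H.subset by blast
    show "Ind.invariant ?K (supported (\<Union>(dcoset x)))"
      using inv by (rule Ind.invariant_mono) blast
    fix C assume "C \<in> dcoset x"
    then obtain h where h: "h \<in> H" "C = H #> (x \<otimes> h)" by (auto simp: dcoset_def)
    have xh: "x \<otimes> h \<in> carrier G" using x h by simp
    have K: "H \<inter> conj_sub (x \<otimes> h) = ?K" by (rule Int_conj_mult[OF x h(1)])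
    have "Ind.invariant ?K (supported C)"
      using invariant_supported_rcoset[OF xh] unfolding h(2)
      by (rule Ind.invariant_mono) (use K in blast)
    moreover have "Ind.complemented ?K (supported C)"
      using complemented_supported_rcoset[OF xh] by (simp only: K h(2))
    ultimately show "left_stable C \<and> Ind.invariant ?K (supported C) \<and> Ind.complemented ?K (supported C)"
      using left_stable_rcoset[OF xh] h(2) by simp
  qed
  moreover obtain F where "finite F" "F \<subseteq> H" "\<And>h. h \<in> H \<Longrightarrow> \<exists>f\<in>F. inv f \<otimes> h \<in> ?K"
    using G.proximate_normalD(2)[OF proximate x] by blast
  ultimately show ?thesis
    using Ind.complemented_of_finite_index[OF H.subgroup_axioms subgroup_Int_conj[OF x] Int_lower1 _ _ _ inv]
    by blast
qed

text \<open>The restriction of the induced representation to \<open>H\<close> is locally semisimple.\<close>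

lemma in_complemented:
  assumes f: "f \<in> I"
  obtains M where "Ind.invariant H M" "Ind.complemented H M" "f \<in> M"
proof -
  obtain C where C: "C \<subseteq> rcosets H" "finite C" "{x. f x \<noteq> 0} \<subseteq> \<Union>C"
    using f by (auto simp: ind_space_def)
  obtain X where X: "finite X" "X \<subseteq> carrier G" "C = (\<lambda>x. H #> x) ` X"
  proof -
    have "C \<subseteq> (\<lambda>x. H #> x) ` carrier G" using C(1) by (auto simp: RCOSETS_def)
    from finite_subset_image[OF C(2) this] show ?thesis using that by blast
  qed
  let ?\<D> = "(\<lambda>x. \<Union>(dcoset x)) ` X"
  have Xc: "x \<in> carrier G" if "x \<in> X" for x using that X by blast
  have inv: "Ind.invariant H (supported (\<Union>?\<D>))"
  proof (rule invariant_supported[OF H.subset])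
    fix y k assume k: "k \<in> H" "y \<in> carrier G" "y \<otimes> k \<in> \<Union>?\<D>"
    then obtain x where x: "x \<in> X" "y \<otimes> k \<in> \<Union>(dcoset x)" by blast
    have "y \<in> \<Union>(dcoset x)" by (rule right_stable_dcoset[OF Xc[OF x(1)] k(1,2) x(2)])
    then show "y \<in> \<Union>?\<D>" using x(1) by blast
  qed
  have "Ind.complemented H (supported (\<Union>?\<D>))"
  proof (rule complemented_supported_Union[OF _ H.subset _ inv])
    fix D assume "D \<in> ?\<D>"
    then obtain x where x: "x \<in> carrier G" "D = \<Union>(dcoset x)" using Xc by blast
    have "Ind.invariant H (supported D)"
      unfolding x(2) by (rule invariant_supported[OF H.subset]) (rule right_stable_dcoset[OF x(1)])
    then show "left_stable D \<and> Ind.invariant H (supported D) \<and> Ind.complemented H (supported D)"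
      using left_stable_dcoset complemented_supported_dcoset x by blast
  qed (use X(1) in simp)
  moreover have "f \<in> supported (\<Union>?\<D>)"
  proof -
    have "y \<in> \<Union>?\<D>" if fy: "f y \<noteq> 0" for y
    proof -
      obtain x where x: "x \<in> X" "y \<in> H #> x" using C(3) X(3) fy by blast
      have "H #> x = H #> (x \<otimes> \<one>)" using x Xc by simp
      then have "H #> x \<in> dcoset x" unfolding dcoset_def using H.one_closed by blast
      then show ?thesis using x by blast
    qed
    then show ?thesis using f by (simp add: supported_def)
  qed
  ultimately show ?thesis using inv that by blast
qed

section \<open>Irreducibility\<close>

lemma conj_sub_one: "conj_sub \<one> = H"
  using G.mem_conj_subgroup_iff[OF H.subgroup_axioms G.one_closed] H.subset by auto

text \<open>
  Semisimplicity over \<open>H\<close> splits the surjective evaluation at the identity from \<open>U\<close> to \<open>W\<close>.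
\<close>

lemma section_into_invariant:
  assumes U: "Ind.invariant (carrier G) U" "U \<noteq> {0}"
  obtains s where "\<And>w. w \<in> W \<Longrightarrow> s w \<in> U" "\<And>w. w \<in> W \<Longrightarrow> s w \<one> = w"
    "\<And>v w. v \<in> W \<Longrightarrow> w \<in> W \<Longrightarrow> s (v + w) = s v + s w"
    "\<And>c w. w \<in> W \<Longrightarrow> s (scale c w) = pointwise_scale scale c (s w)"
    "\<And>h w. h \<in> H \<Longrightarrow> w \<in> W \<Longrightarrow> s (\<rho> h w) = \<pi> h (s w)"
proof -
  have UI: "U \<subseteq> I" using U(1) Ind.invariant_subset by blast
  have UH: "Ind.invariant H U" using U(1) H.subset Ind.invariant_mono by blast
  obtain f0 where f0: "f0 \<in> U" "f0 \<noteq> 0" using U(2) Ind.invariant_0[OF U(1)] by blast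
  then obtain x where x: "f0 x \<noteq> 0" by (auto simp: fun_eq_iff)
  have xc: "x \<in> carrier G" using x f0 UI outside by blast
  define f where "f = \<pi> x f0"
  have f: "f \<in> U" unfolding f_def using Ind.invariant_act[OF U(1) xc f0(1)] .
  have "f0 \<in> I" using f0 UI by blast
  then have f1: "f \<one> \<noteq> 0" using x xc by (simp add: f_def act_apply)
  obtain M where M: "Ind.invariant H M" "Ind.complemented H M" "f \<in> M"
    using in_complemented f UI by blast
  \<comment> \<open>\<open>U\<close> is cut down to a semisimple submodule that already contains \<open>f\<close>, so that evaluation
    remains onto.\<close>
  have UM: "Ind.invariant H (U \<inter> M)" by (rule Ind.invariant_Int[OF UH M(1)])
  have "(\<lambda>f. f \<one>) ` (U \<inter> M) = {0} \<or> (\<lambda>f. f \<one>) ` (U \<inter> M) = W"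
    using eval_image[OF G.one_closed, of "U \<inter> M"] UM conj_sub_one by simp
  then have onto: "(\<lambda>f. f \<one>) ` (U \<inter> M) = W" using f f1 M(3) by blast
  have act1: "\<pi> h f' \<one> = \<rho> h (f' \<one>)" if "h \<in> H" "f' \<in> I" for h f'
    using that equivariant[of f' h \<one>] by (simp add: act_apply)
  let ?N = "{f' \<in> U \<inter> M. f' \<one> = 0}"
  have sUM: "Ind.subspace (U \<inter> M)" using UM Ind.invariant_subspace by blast
  have sN: "Ind.subspace ?N"
  proof (rule Ind.subspaceI)
    show "0 \<in> ?N" using Ind.subspace_0[OF sUM] by simp
  next
    fix a b assume "a \<in> ?N" "b \<in> ?N"
    then show "a + b \<in> ?N" using Ind.subspace_add[OF sUM, of a b] by simp
  next
    fix c a assume "a \<in> ?N"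
    then show "pointwise_scale scale c a \<in> ?N"
      using Ind.subspace_scale[OF sUM, of a c] by (simp add: pointwise_scale_def)
  qed
  have N: "Ind.invariant H ?N"
    unfolding Ind.invariant_def
  proof (intro conjI ballI sN)
    show "?N \<subseteq> I" using UI by blast
    fix h a assume h: "h \<in> H" and a: "a \<in> ?N"
    have "\<pi> h a \<in> U \<inter> M" using Ind.invariant_act[OF UM h] a by blast
    moreover have "\<pi> h a \<one> = 0" using a UI h act1[OF h, of a] rho_zero by auto
    ultimately show "\<pi> h a \<in> ?N" by simp
  qed
  have NM: "?N \<subseteq> M" by blast
  obtain B where B: "Ind.invariant H B" "B \<subseteq> M" "?N \<inter> B = {0}"
      "\<And>m. m \<in> M \<Longrightarrow> \<exists>a\<in>?N. \<exists>b\<in>B. m = a + b"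
    by (rule Ind.complementedE[OF M(2) N NM], rule that)
  let ?S = "U \<inter> B"
  have S: "Ind.invariant H ?S" by (rule Ind.invariant_Int[OF UH B(1)])
  note sS = Ind.invariant_subspace[OF S]
  have unique: "a = b" if "a \<in> ?S" "b \<in> ?S" "a \<one> = b \<one>" for a b
  proof -
    have "a - b \<in> ?S" using that Ind.subspace_diff[OF sS] by blast
    moreover have "(a - b) \<one> = 0" using that by simp
    ultimately have "a - b \<in> ?N \<inter> B" using B(2) by blast
    then have "a - b = 0" using B(3) by blast
    then show ?thesis by simp
  qed
  have ex: "\<exists>b. b \<in> ?S \<and> b \<one> = w" if w: "w \<in> W" for w
  proof -
    obtain u where u: "u \<in> U" "u \<in> M" "u \<one> = w" using onto w by blast
    obtain a b where ab: "a \<in> ?N" "b \<in> B" "u = a + b" using B(4)[OF u(2)] by blast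
    have "u - a \<in> U" using u ab Ind.subspace_diff[OF Ind.invariant_subspace[OF U(1)]] by blast
    then have "b \<in> ?S" using ab by simp
    moreover have "b \<one> = w" using ab u(3) by simp
    ultimately show ?thesis by blast
  qed
  \<comment> \<open>Evaluation at the identity maps \<open>?S\<close> bijectively onto \<open>W\<close>; the section inverts it.\<close>
  define s where "s w = (SOME b. b \<in> ?S \<and> b \<one> = w)" for w
  have s: "s w \<in> ?S" "s w \<one> = w" if "w \<in> W" for w
    using someI_ex[OF ex[OF that]] by (auto simp: s_def)
  have eq: "s w = b" if "w \<in> W" "b \<in> ?S" "b \<one> = w" for w b
    using unique[of "s w" b] s[OF that(1)] that by simp
  show ?thesis
  proof (rule that)
    show "s w \<in> U" "s w \<one> = w" if "w \<in> W" for w using s[OF that] by auto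
  next
    fix v w assume vw: "v \<in> W" "w \<in> W"
    show "s (v + w) = s v + s w"
      by (rule eq) (use vw s W.subspace_add[OF W.subspace_space] in
          \<open>auto intro: Ind.subspace_add[OF Ind.invariant_subspace[OF U(1)]]
            Ind.subspace_add[OF Ind.invariant_subspace[OF B(1)]]\<close>)
  next
    fix c w assume w: "w \<in> W"
    show "s (scale c w) = pointwise_scale scale c (s w)"
    proof (rule eq)
      show "scale c w \<in> W" using w W.subspace_scale[OF W.subspace_space] by blast
      show "pointwise_scale scale c (s w) \<in> ?S" using s(1)[OF w] Ind.subspace_scale[OF sS] by blast
      show "pointwise_scale scale c (s w) \<one> = scale c w"
        using s(2)[OF w] by (simp add: pointwise_scale_def)
    qed
  next
    fix h w assume h: "h \<in> H" and w: "w \<in> W"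
    show "s (\<rho> h w) = \<pi> h (s w)"
    proof (rule eq)
      show "\<rho> h w \<in> W" using W.action_closed[of h w] h w by simp
      show "\<pi> h (s w) \<in> ?S" using s(1)[OF w] Ind.invariant_act[OF S h] by blast
      have "s w \<in> I" using s(1)[OF w] UI by blast
      then show "\<pi> h (s w) \<one> = \<rho> h w" using act1[OF h] s(2)[OF w] by simp
    qed
  qed
qed

text \<open>The functions supported on \<open>H\<close> generate the induced representation.\<close>

lemma invariant_eq_space:
  assumes U: "Ind.invariant (carrier G) U" "supported H \<subseteq> U"
  shows "U = I"
proof
  show "U \<subseteq> I" using U(1) Ind.invariant_subset by blast
  have coset: "supported (H #> x) \<subseteq> U" if x: "x \<in> carrier G" for x
  proof
    fix f assume f: "f \<in> supported (H #> x)"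
    have "\<pi> x f \<in> supported H"
    proof (rule act_supported[OF x f])
      fix y assume y: "y \<in> carrier G" "y \<otimes> x \<in> H #> x"
      then obtain h where h: "h \<in> H" "y \<otimes> x = h \<otimes> x" by (auto simp: r_coset_def)
      then show "y \<in> H" using x y by simp
    qed
    then have "\<pi> (inv x) (\<pi> x f) \<in> U" using U Ind.invariant_act[OF U(1)] x by blast
    then show "f \<in> U" using Ind.action_inv_left x f supported_subset by fastforce
  qed
  have union: "left_stable (\<Union>\<C>) \<and> supported (\<Union>\<C>) \<subseteq> U" if "finite \<C>" "\<C> \<subseteq> rcosets H" for \<C>
    using that
  proof (induction \<C>)
    case empty
    have "f = 0" if "f \<in> supported {}" for f
      using that by (auto simp: supported_def fun_eq_iff)
    then show ?case using Ind.invariant_0[OF U(1)] by (auto simp: left_stable_def)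
  next
    case (insert C \<C>)
    then obtain x where x: "x \<in> carrier G" "C = H #> x" by (auto simp: RCOSETS_def)
    have ls: "left_stable C" "left_stable (\<Union>\<C>)" using left_stable_rcoset x insert by auto
    have "f \<in> U" if f: "f \<in> supported (C \<union> \<Union>\<C>)" for f
    proof -
      obtain a b where "a \<in> supported C" "b \<in> supported (\<Union>\<C>)" "f = a + b"
        using split_supported[OF f ls] by blast
      moreover have "supported C \<subseteq> U" "supported (\<Union>\<C>) \<subseteq> U" using coset x insert by auto
      ultimately show ?thesis using Ind.subspace_add[OF Ind.invariant_subspace[OF U(1)]] by blast
    qed
    moreover have "left_stable (C \<union> \<Union>\<C>)" using ls by (auto simp: left_stable_def)
    ultimately show ?case by auto
  qed
  show "I \<subseteq> U"
  proof
    fix f assume f: "f \<in> I"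
    obtain C where C: "C \<subseteq> rcosets H" "finite C" "{x. f x \<noteq> 0} \<subseteq> \<Union>C"
      using f by (auto simp: ind_space_def)
    then have "f \<in> supported (\<Union>C)" using f by (auto simp: supported_def)
    then show "f \<in> U" using union C by blast
  qed
qed

end

theorem theorem1p2:
  fixes G :: "('g, 'm) monoid_scheme"
    and H :: "'g set"
    and scale :: "complex \<Rightarrow> 'w::ab_group_add \<Rightarrow> 'w"
    and W :: "'w set"
    and \<rho> :: "'g \<Rightarrow> 'w \<Rightarrow> 'w"
  assumes "group G"
    and "proximate_normal H G"
    and "irreducible_representation (G\<lparr>carrier := H\<rparr>) scale W \<rho>"
    and "schur_irreducible_representation G (pointwise_scale scale)
           (ind_space G H W \<rho>) (ind_action G H W \<rho>)"
  shows "irreducible_representation G (pointwise_scale scale)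
           (ind_space G H W \<rho>) (ind_action G H W \<rho>)"
proof -
  have "subgroup H G" using assms(2) by (simp add: proximate_normal_def)
  then interpret induced_from_proximate_normal G H scale W \<rho>
    using assms(1-3)
    by (intro induced_from_proximate_normal.intro induced_from_irreducible.intro
        induced_from_proximate_normal_axioms.intro)
  interpret schur: schur_irreducible_representation G "pointwise_scale scale" I \<pi>
    by fact
  show ?thesis
  proof (intro irreducible_representation.intro irreducible_representation_axioms.intro
      Ind.representation_axioms schur.space_nonzero)
    fix U assume "Ind.subspace U" "U \<subseteq> I" "\<And>g u. g \<in> carrier G \<Longrightarrow> u \<in> U \<Longrightarrow> \<pi> g u \<in> U"
    then have U: "Ind.invariant (carrier G) U" by (simp add: Ind.invariant_def)
    show "U = {0} \<or> U = I"
    proof (cases "U = {0}")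
      case False
      obtain s where s: "\<And>w. w \<in> W \<Longrightarrow> s w \<in> U" "\<And>w. w \<in> W \<Longrightarrow> s w \<one>\<^bsub>G\<^esub> = w"
        "\<And>v w. v \<in> W \<Longrightarrow> w \<in> W \<Longrightarrow> s (v + w) = s v + s w"
        "\<And>c w. w \<in> W \<Longrightarrow> s (scale c w) = pointwise_scale scale c (s w)"
        "\<And>h w. h \<in> H \<Longrightarrow> w \<in> W \<Longrightarrow> s (\<rho> h w) = \<pi> h (s w)"
        by (rule section_into_invariant[OF U False], rule that)
      have sI: "s w \<in> I" if "w \<in> W" for w
        using s(1)[OF that] Ind.invariant_subset[OF U] by blast
      obtain T where T: "T \<in> endomorphisms G (pointwise_scale scale) I \<pi>"
        "\<And>f. f \<in> supported H \<Longrightarrow> T f = s (f \<one>\<^bsub>G\<^esub>)"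
        by (rule frobenius_extension[OF sI s(3-5)], assumption+, rule that)
      obtain c where c: "\<And>f. f \<in> I \<Longrightarrow> T f = pointwise_scale scale c f"
        by (rule schur.endomorphism_scalar[OF T(1)], rule that)
      have "supported H \<subseteq> U"
      proof
        fix f assume f: "f \<in> supported H"
        have fI: "f \<in> I" using f supported_subset by blast
        define w where "w = f \<one>\<^bsub>G\<^esub>"
        have w: "w \<in> W" using fI value_in by (simp add: w_def)
        have sf: "s w = pointwise_scale scale c f" using T(2)[OF f] c[OF fI] by (simp add: w_def)
        \<comment> \<open>Evaluation at the identity determines the scalar.\<close>
        then have cw: "scale c w = w" using s(2)[OF w] by (simp add: pointwise_scale_def w_def)
        show "f \<in> U"
        proof (cases "w = 0")
          case True
          have "f = 0"
          proof
            fix x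
            show "f x = (0 :: 'g \<Rightarrow> 'w) x"
            proof (cases "x \<in> H")
              case True
              then show ?thesis
                using equivariant[OF fI True, of "\<one>\<^bsub>G\<^esub>"] \<open>w = 0\<close> rho_zero by (simp add: w_def)
            next
              case False
              then show ?thesis using f by (auto simp: supported_def)
            qed
          qed
          then show ?thesis using Ind.invariant_0[OF U] by simp
        next
          case False
          then have "c = 1" using cw W.scale_right_imp_eq[of w c 1] by simp
          then have "s w = f" using sf by (simp add: pointwise_scale_def)
          then show ?thesis using s(1)[OF w] by simp
        qed
      qed
      then show ?thesis using invariant_eq_space[OF U] by blast
    qed simp
  qed
qed

end
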